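(* Let $0<\lambda\le\Lambda$ and let $\Omega\subset\mathbb{R}^n$ be a domain that satisfies the anti-interior $C^{1,\mathrm{Dini}}$ condition at $0\in\partial\Omega$, with corresponding function $\omega_\Omega$. Then there exist $\delta>0$ and a function $\tilde\omega:(0,\delta)\to[0,+\infty)$ such that $\tilde\omega(r)\to0$ decreasingly as $r\to0$ (i.e. $\tilde\omega$ is nondecreasing in $r$ with limit $0$ at $0$), both depending only on $n,\lambda,\Lambda$ and $\omega_\Omega$, such that the following holds. If $u\in C(\bar\Omega\cap B_1)$ satisfies $$\mathcal{M}^+(D^2u,\lambda,\Lambda)\ge0\ \text{ in }\ \Omega\cap B_1\quad(\text{i.e., } u\in\underline{S}(\lambda,\Lambda,0)\text{ in }\Omega\cap B_1),$$ with $u\le0$ on $\partial\Omega\cap B_1$, then $$u(x)\le\left(\sup_{\Omega\cap B_1}u^+\right)|x|\,\tilde\omega(|x|)\qquad\text{for all } x\in\Omega\cap B_\delta.$$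
   Context: Notation: $B_r=B_r(0)$ is the open ball of radius $r$ centered at $0$ in $\mathbb{R}^n$; $x=(x',x_n)$ with $x'\in\mathbb{R}^{n-1}$; $\Omega^c=\mathbb{R}^n\setminus\Omega$; $u^+=\max(u,0)$. Anti-interior $C^{1,\mathrm{Dini}}$ condition at $0\in\partial\Omega$: there exist $r_0>0$, a coordinate system $\{x_1,\dots,x_n\}$ with origin at the boundary point $0$, and a nondecreasing function $\omega_\Omega:[0,+\infty)\to[0,+\infty)$ such that $$B_{r_0}\cap\{x_n\le|x'|\omega_\Omega(|x'|)\}\subset B_{r_0}\cap\Omega^c,$$ where $\omega_\Omega(r)\to0$ as $r\to0$ and $\omega_\Omega$ does not satisfy the Dini condition, i.e. $\int_0^{r_0}\frac{\omega_\Omega(r)}{r}\,dr=+\infty$. It is assumed throughout that $r_0=1$ and $\omega_\Omega(1)<1/4$. Pucci extremal operator: for a symmetric $n\times n$ matrix $M$ with eigenvalues $\lambda_1,\dots,\lambda_n$, $$\mathcal{M}^+(M,\lambda,\Lambda)=\Lambda\sum_{\lambda_i>0}\lambda_i+\lambda\sum_{\lambda_i<0}\lambda_i.$$ Pucci class: for $D\subset\mathbb{R}^n$ open, $u\in\underline{S}(\lambda,\Lambda,0)$ in $D$ (also written $\mathcal{M}^+(D^2u,\lambda,\Lambda)\ge0$ in $D$) means that $u\in C(D)$ is an $L^n$-viscosity subsolution of $\mathcal{M}^+(D^2u,\lambda,\Lambda)=0$ in $D$: whenever $\varphi\in W^{2,n}(D)$ and $u-\varphi$ attains a local maximum at $x\in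 D$, one has $\mathrm{ess}\limsup_{y\to x}\mathcal{M}^+(D^2\varphi(y),\lambda,\Lambda)\ge0$. *)

theory Defs
  imports
    "HOL-Analysis.Analysis"
    "HOL-Probability.Essential_Supremum"
    "HOL-Computational_Algebra.Computational_Algebra"
begin

section \<open>The Pucci extremal operator\<close>

definition charpoly :: "real ^ 'n ^ 'n \<Rightarrow> real poly" where
  "charpoly M = det (\<chi> i j. (if i = j then [:0, 1:] else 0) - [:M $ i $ j:])"

text \<open>For a symmetric matrix \<^term>\<open>charpoly M\<close> splits over the reals, so its multiset of roots
  consists of the \<open>n\<close> eigenvalues with multiplicity.\<close>

definition eigenvalues :: "real ^ 'n ^ 'n \<Rightarrow> real multiset" where
  "eigenvalues M = proots (charpoly M)"

definition pucci_max :: "real \<Rightarrow> real \<Rightarrow> real ^ 'n ^ 'n \<Rightarrow> real" where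
  "pucci_max lam Lam M =
     Lam * (\<Sum>\<mu> \<in># filter_mset (\<lambda>\<mu>. \<mu> > 0) (eigenvalues M). \<mu>) +
     lam * (\<Sum>\<mu> \<in># filter_mset (\<lambda>\<mu>. \<mu> < 0) (eigenvalues M). \<mu>)"

section \<open>Weak derivatives and the Sobolev space \<open>W\<^sup>2\<^sup>,\<^sup>p\<close>\<close>

definition partial :: "'n \<Rightarrow> (real ^ 'n \<Rightarrow> real) \<Rightarrow> real ^ 'n \<Rightarrow> real" where
  "partial i f x = frechet_derivative f (at x) (axis i 1)"

fun Ck :: "nat \<Rightarrow> (real ^ 'n \<Rightarrow> real) \<Rightarrow> bool" where
  "Ck 0 f \<longleftrightarrow> continuous_on UNIV f"
| "Ck (Suc k) f \<longleftrightarrow> (\<forall>x. f differentiable (at x)) \<and> (\<forall>i. Ck k (partial i f))"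

definition test_function :: "(real ^ 'n) set \<Rightarrow> (real ^ 'n \<Rightarrow> real) \<Rightarrow> bool" where
  "test_function D \<psi> \<longleftrightarrow>
     (\<forall>k. Ck k \<psi>) \<and> compact (closure {x. \<psi> x \<noteq> 0}) \<and> closure {x. \<psi> x \<noteq> 0} \<subseteq> D"

definition locally_integrable :: "(real ^ 'n) set \<Rightarrow> (real ^ 'n \<Rightarrow> real) \<Rightarrow> bool" where
  "locally_integrable D f \<longleftrightarrow> (\<forall>K. compact K \<and> K \<subseteq> D \<longrightarrow> integrable (lebesgue_on K) f)"

definition weak_partial ::
    "(real ^ 'n) set \<Rightarrow> 'n \<Rightarrow> (real ^ 'n \<Rightarrow> real) \<Rightarrow> (real ^ 'n \<Rightarrow> real) \<Rightarrow> bool" where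
  "weak_partial D i f g \<longleftrightarrow>
     locally_integrable D f \<and> locally_integrable D g \<and>
     (\<forall>\<psi>. test_function D \<psi> \<longrightarrow>
        (LINT x|lebesgue_on D. f x * partial i \<psi> x) = - (LINT x|lebesgue_on D. g x * \<psi> x))"

definition in_Lp :: "nat \<Rightarrow> (real ^ 'n) set \<Rightarrow> (real ^ 'n \<Rightarrow> real) \<Rightarrow> bool" where
  "in_Lp p D f \<longleftrightarrow>
     f \<in> borel_measurable (lebesgue_on D) \<and> integrable (lebesgue_on D) (\<lambda>x. \<bar>f x\<bar> ^ p)"

text \<open>\<open>\<phi> \<in> W\<^sup>2\<^sup>,\<^sup>p(D)\<close>, with \<open>G\<close> and \<open>H\<close> representing its weak gradient and weak Hessian.\<close>

definition sobolev2 :: "nat \<Rightarrow> (real ^ 'n) set \<Rightarrow> (real ^ 'n \<Rightarrow> real) \<Rightarrow>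
    (real ^ 'n \<Rightarrow> real ^ 'n) \<Rightarrow> (real ^ 'n \<Rightarrow> real ^ 'n ^ 'n) \<Rightarrow> bool" where
  "sobolev2 p D \<phi> G H \<longleftrightarrow>
     in_Lp p D \<phi> \<and>
     (\<forall>i. in_Lp p D (\<lambda>x. G x $ i) \<and> weak_partial D i \<phi> (\<lambda>x. G x $ i)) \<and>
     (\<forall>i j. in_Lp p D (\<lambda>x. H x $ i $ j) \<and> weak_partial D j (\<lambda>x. G x $ i) (\<lambda>x. H x $ i $ j))"

section \<open>\<open>L\<^sup>n\<close>-viscosity subsolutions\<close>

definition ess_limsup_at ::
    "(real ^ 'n) set \<Rightarrow> real ^ 'n \<Rightarrow> (real ^ 'n \<Rightarrow> real) \<Rightarrow> ereal" where
  "ess_limsup_at D x f = (INF r\<in>{0<..}. esssup (lebesgue_on (D \<inter> ball x r)) (\<lambda>y. ereal (f y)))"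

text \<open>Elements of \<open>W\<^sup>2\<^sup>,\<^sup>n\<close> are taken in their continuous representative (which exists by Sobolev
  embedding), since the pointwise condition that \<open>u - \<phi>\<close> has a local maximum at \<open>x\<close> is not
  invariant under changes on null sets. The weak Hessian \<open>H\<close> is unique, and symmetric, up to a
  null set, so quantifying over all its representatives is harmless.\<close>

definition pucci_subsolution ::
    "real \<Rightarrow> real \<Rightarrow> (real ^ 'n) set \<Rightarrow> (real ^ 'n \<Rightarrow> real) \<Rightarrow> bool" where
  "pucci_subsolution lam Lam D u \<longleftrightarrow>
     continuous_on D u \<and>
     (\<forall>\<phi> G H. continuous_on D \<phi> \<and> sobolev2 CARD('n) D \<phi> G H \<longrightarrow>
        (\<forall>x\<in>D. (\<forall>\<^sub>F y in at x within D. u y - \<phi> y \<le> u x - \<phi> x) \<longrightarrow>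
           ess_limsup_at D x (\<lambda>y. pucci_max lam Lam (H y)) \<ge> 0))"

section \<open>The anti-interior \<open>C\<^sup>1\<^sup>,\<^sup>D\<^sup>i\<^sup>n\<^sup>i\<close> condition at the origin\<close>

text \<open>The coordinate system is orthonormal, given by the orthogonal map \<open>T\<close> sending a point to its
  coordinates, with \<open>m\<close> the index of the last coordinate \<open>x\<^sub>n\<close>. Only the values of \<open>\<omega>\<close> on
  \<open>[0, \<infinity>)\<close> matter.\<close>

definition tangential :: "'n \<Rightarrow> real ^ 'n \<Rightarrow> real ^ 'n" where
  "tangential m x = (\<chi> i. if i = m then 0 else x $ i)"

definition anti_interior_C1Dini :: "(real ^ 'n) set \<Rightarrow> real \<Rightarrow> (real \<Rightarrow> real) \<Rightarrow> bool" where
  "anti_interior_C1Dini \<Omega> r0 \<omega> \<longleftrightarrow>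
     0 \<in> frontier \<Omega> \<and> 0 < r0 \<and>
     mono_on {0..} \<omega> \<and> (\<forall>r\<ge>0. 0 \<le> \<omega> r) \<and>
     (\<omega> \<longlongrightarrow> 0) (at_right 0) \<and>
     (\<integral>\<^sup>+ r\<in>{0<..<r0}. ennreal (\<omega> r / r) \<partial>lborel) = \<infinity> \<and>
     (\<exists>(T :: real ^ 'n \<Rightarrow> real ^ 'n) m. orthogonal_transformation T \<and>
        ball 0 r0 \<inter> {x. T x $ m \<le> norm (tangential m (T x)) * \<omega> (norm (tangential m (T x)))}
          \<subseteq> ball 0 r0 \<inter> - \<Omega>)"

end

theory Submission
  imports Defs
begin

text \<open>Comparison with a barrier on balls touching the hyperplane from below gives
  \<open>u \<le> C * M * x\<^sub>n\<close> near the origin, with \<open>M\<close> the supremum. If \<open>u \<le> a * x\<^sub>n\<close> in a ball of radius \<open>r\<close>, then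
  \<open>a * x\<^sub>n - u\<close> is a nonnegative supersolution that is at least of order \<open>a * r * \<omega>(r / 20)\<close> on the
  part of the boundary at tangential distance comparable to \<open>r\<close>; Hopf-type barriers propagate this
  gain to the axis and back to the origin, so \<open>u \<le> a * (1 - c * \<omega>(r / 20)) * x\<^sub>n\<close> in the ball of
  radius \<open>r / 160\<close>. Since the Dini integral diverges, the product of the factors over all scales
  is \<open>0\<close>. All barriers have the form \<open>exp (- \<alpha> * norm (x - z) ^ 2)\<close>: these are globally smooth,
  hence admissible test functions, and the Hessian is a rank-one perturbation of a multiple of the
  identity, with explicit eigenvalues.\<close>

section \<open>Pucci operator of a rank-one perturbation\<close>

text \<open>Apart from lying above the graph, nothing is known about how the boundary runs inside a
  ball, so no interior ball of \<Omega> is available for a Harnack chain. Each barrier is therefore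
  compared on an annulus cut by \<Omega>. On the frontier only u \<le> 0 is used, so the Gaussian
  term must stay below the affine majorant there. The inner ball either misses \<Omega> or lies
  where a gain is already known. In units of the current scale the inner radii never drop below 1/4,
  so one exponent \<alpha> serves all barriers and every constant depends on n, \<open>lam\<close>
  and \<open>Lam\<close> only. Since the Pucci operator is defined through roots of
  \<open>charpoly\<close>, eigenvalues are reached through a determinant; since test functions range
  over W^{2,n}, the smooth barriers need their weak derivatives identified.\<close>

lemma poly_charpoly:
  fixes M :: "real ^ 'n ^ 'n"
  shows "poly (charpoly M) x = det (mat x - M)"
proof -
  have "poly (charpoly M) x =
    (\<Sum>p | p permutes UNIV. poly (of_int (sign p) *
      (\<Prod>i\<in>UNIV. (if i = p i then [:0, 1:] else 0) - [:M $ i $ p i:])) x)"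
    by (simp add: charpoly_def det_def poly_sum)
  also have "\<dots> = det (mat x - M)"
    unfolding det_def
    by (intro sum.cong refl) (auto simp: poly_prod mat_def intro!: arg_cong2[where f="(*)"] prod.cong)
  finally show ?thesis .
qed

definition rank1_pert :: "real \<Rightarrow> real \<Rightarrow> real ^ 'n \<Rightarrow> real ^ 'n ^ 'n" where
  "rank1_pert c d y = (\<chi> i j. (if i = j then c else 0) + d * (y $ i * y $ j))"

text \<open>A rotation taking \<open>y\<close> to a multiple of a coordinate axis diagonalises the
  matrix: the entry on that axis becomes \<open>c + d * (y \<bullet> y)\<close>, all others are
  \<open>c\<close>. The argument covers \<open>y = 0\<close> as well.\<close>

lemma det_rank1_pert:
  fixes y :: "real ^ 'n"
  shows "det (rank1_pert c d y) = c ^ (CARD('n) - 1) * (c + d * (y \<bullet> y))"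
proof -
  \<comment> \<open>Any index will do; it only names the axis onto which \<open>y\<close> is
    rotated.\<close>
  obtain k :: 'n where True by simp
  have "norm y = norm (norm y *\<^sub>R axis k (1::real))" by simp
  then obtain f :: "real ^ 'n \<Rightarrow> real ^ 'n"
    where f: "orthogonal_transformation f" "f y = norm y *\<^sub>R axis k 1"
    by (rule orthogonal_transformation_exists)
  define Q where "Q = matrix f"
  have Q: "transpose Q ** Q = mat 1" "Q ** transpose Q = mat 1" "Q *v y = norm y *\<^sub>R axis k 1"
    using f unfolding Q_def
    by (auto simp: orthogonal_transformation_matrix orthogonal_matrix_def matrix_works)
  have y: "y $ j = norm y * Q $ k $ j" for j
  proof -
    have "y = transpose Q *v (Q *v y)" by (simp add: matrix_vector_mul_assoc Q(1))
    then have "y = transpose Q *v (norm y *\<^sub>R axis k 1)" by (simp only: Q(3))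
    then have "y $ j = (transpose Q *v (norm y *\<^sub>R axis k 1)) $ j" by (rule arg_cong)
    also have "\<dots> = (\<Sum>l\<in>UNIV. if l = k then norm y * Q $ k $ j else 0)"
      unfolding matrix_vector_mult_def transpose_def vec_lambda_beta
      by (rule sum.cong) (auto simp: axis_def)
    finally show ?thesis by simp
  qed
  define B :: "real ^ 'n ^ 'n" where
    "B = (\<chi> i j. if i = j then c + (if i = k then d * (y \<bullet> y) else 0) else 0)"
  have "rank1_pert c d y = transpose Q ** B ** Q"
  proof -
    have 1: "(\<Sum>l\<in>UNIV. Q $ l $ i * Q $ l $ j) = (if i = j then 1 else 0)" for i j
      using Q(1) by (simp add: vec_eq_iff matrix_matrix_mult_def transpose_def mat_def)
    have "(transpose Q ** B ** Q) $ i $ j = (rank1_pert c d y) $ i $ j" for i j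
    proof -
      have "(transpose Q ** B ** Q) $ i $ j =
          (\<Sum>l\<in>UNIV. Q $ l $ i * (c + (if l = k then d * (y \<bullet> y) else 0)) * Q $ l $ j)"
        by (simp add: matrix_matrix_mult_def transpose_def B_def if_distrib[where f="(*) _"] cong: if_cong)
      also have "\<dots> = (\<Sum>l\<in>UNIV. c * (Q $ l $ i * Q $ l $ j) +
          (if l = k then d * (y \<bullet> y) * (Q $ l $ i * Q $ l $ j) else 0))"
        by (intro sum.cong) (auto simp: algebra_simps)
      also have "\<dots> = c * (if i = j then 1 else 0) + d * (y \<bullet> y) * (Q $ k $ i * Q $ k $ j)"
        by (simp add: sum.distrib 1 flip: sum_distrib_left)
      also have "\<dots> = (rank1_pert c d y) $ i $ j"
        by (simp add: rank1_pert_def y[of i] y[of j] power2_norm_eq_inner[symmetric] power2_eq_square)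
      finally show ?thesis .
    qed
    then show ?thesis by (simp add: vec_eq_iff)
  qed
  then have "det (rank1_pert c d y) = det (transpose Q ** Q) * det B"
    by (simp add: det_mul)
  also have "\<dots> = det B" by (simp add: Q)
  also have "\<dots> = (\<Prod>i\<in>UNIV. c + (if i = k then d * (y \<bullet> y) else 0))"
    by (subst det_diagonal) (auto simp: B_def)
  also have "\<dots> = c ^ (CARD('n) - 1) * (c + d * (y \<bullet> y))"
    by (subst prod.remove[of _ k]) (auto simp: card_Diff_singleton)
  finally show ?thesis .
qed

text \<open>Subtracting the matrix from \<open>mat x\<close> gives a matrix of the same shape, so
  the determinant formula yields the value at every \<open>x\<close>, and a real polynomial is
  determined by its values.\<close>

lemma charpoly_rank1_pert:
  fixes y :: "real ^ 'n"
  shows "charpoly (rank1_pert c d y) = [:- c, 1:] ^ (CARD('n) - 1) * [:- (c + d * (y \<bullet> y)), 1:]"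
proof -
  have "mat x - rank1_pert c d y = rank1_pert (x - c) (- d) y" for x
    by (simp add: vec_eq_iff mat_def rank1_pert_def)
  then show ?thesis
    by (subst poly_eq_poly_eq_iff[symmetric])
       (simp add: poly_charpoly det_rank1_pert fun_eq_iff, simp add: algebra_simps)
qed

text \<open>The signs are those of an affine function minus a Gaussian, away from the centre: convex
  in the n - 1 tangential directions, concave in the radial one.\<close>

lemma pucci_max_rank1_pert:
  fixes y :: "real ^ 'n"
  assumes "0 < c" "c + d * (y \<bullet> y) < 0"
  shows "pucci_max lam Lam (rank1_pert c d y) =
    Lam * (real (CARD('n) - 1) * c) + lam * (c + d * (y \<bullet> y))"
proof -
  have "eigenvalues (rank1_pert c d y) =
      replicate_mset (CARD('n) - 1) c + {#c + d * (y \<bullet> y)#}"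
    unfolding eigenvalues_def charpoly_rank1_pert
    by (subst proots_mult) (auto simp: proots_power)
  moreover have "filter_mset P (replicate_mset k c) = (if P c then replicate_mset k c else {#})"
    for P k by (induction k) auto
  ultimately show ?thesis
    using assms by (simp add: pucci_max_def)
qed

section \<open>Classical derivatives as weak derivatives\<close>

lemma integral_lebesgue_translation:
  fixes w :: "'a::euclidean_space \<Rightarrow> real"
  assumes "w \<in> borel_measurable borel"
  shows "(LINT x|lebesgue. w (a + x)) = (LINT x|lebesgue. w x)"
proof -
  have "(LINT x|lebesgue. w (a + x)) = (LINT x|lborel. w (a + x))"
    using measurable_compose[OF _ assms, of "(+) a" lborel] by (intro integral_completion) auto
  also have "\<dots> = (LINT x|distr lborel borel ((+) a). w x)"
    using assms by (subst integral_distr) auto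
  also have "\<dots> = (LINT x|lebesgue. w x)"
    using assms by (simp add: lborel_distr_plus integral_completion)
  finally show ?thesis .
qed

lemma integrable_lebesgue_compact_support:
  fixes w :: "'a::euclidean_space \<Rightarrow> real"
  assumes "continuous_on UNIV w" "\<And>x. norm x > B \<Longrightarrow> w x = 0"
  shows "integrable lebesgue w"
proof -
  have "integrable lebesgue (\<lambda>x. indicat_real (cball 0 B) x *\<^sub>R w x)"
    using borel_integrable_compact[of "cball 0 B" w] continuous_on_subset[OF assms(1)]
    by (subst integrable_completion) (auto dest: borel_measurable_integrable)
  also have "(\<lambda>x. indicat_real (cball 0 B) x *\<^sub>R w x) = w"
    using assms(2) by (auto simp: fun_eq_iff indicator_def)
  finally show ?thesis .
qed

text \<open>Translation invariance makes the integrals of the difference quotients vanish.\<close>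

lemma integral_directional_derivative_eq_0:
  fixes w :: "'a::euclidean_space \<Rightarrow> real"
  assumes der: "\<And>x. (w has_derivative w' x) (at x)"
    and cont: "continuous_on UNIV (\<lambda>x. w' x e)"
    and supp: "\<And>x. norm x > B \<Longrightarrow> w x = 0"
  shows "(LINT x|lebesgue. w' x e) = 0"
proof -
  have contw: "continuous_on UNIV w"
    by (intro continuous_at_imp_continuous_on ballI has_derivative_continuous[OF der])
  have supp': "w' x e = 0" if "norm x > B" for x
  proof -
    have "(w has_derivative (\<lambda>_. 0)) (at x)"
    proof (rule has_derivative_transform_within_open[OF has_derivative_const])
      show "open (- cball 0 B)" by (simp add: open_Compl)
    qed (use that supp in auto)
    then show ?thesis
      using has_derivative_unique[OF der[of x]] by simp
  qed
  have "bounded ((\<lambda>x. w' x e) ` cball 0 B)"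
    by (intro compact_imp_bounded compact_continuous_image continuous_on_subset[OF cont]) auto
  then obtain C0 where "\<forall>y\<in>(\<lambda>x. w' x e) ` cball 0 B. norm y \<le> C0"
    unfolding bounded_iff by blast
  then have C0: "\<bar>w' x e\<bar> \<le> C0" if "x \<in> cball 0 B" for x
    using that by auto
  \<comment> \<open>For negative \<open>B\<close> the ball is empty and \<open>C0\<close> could be
    negative.\<close>
  define C where "C = max C0 0"
  have C: "\<bar>w' x e\<bar> \<le> C" for x
    using C0[of x] supp'[of x] by (cases "norm x \<le> B") (auto simp: C_def)
  \<comment> \<open>Steps of length at most 1 keep all shifted supports inside
    \<open>cball 0 (B + norm e)\<close>, so one dominating function serves every
    \<open>k\<close>.\<close>
  define h where "h k = inverse (real (Suc k))" for k
  have h: "0 < h k" "h k \<le> 1" for k by (auto simp: h_def field_simps)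
  have hlim: "h \<longlonglongrightarrow> 0" unfolding h_def by (rule LIMSEQ_inverse_real_of_nat)
  define s where "s k x = (w (h k *\<^sub>R e + x) - w x) / h k" for k x
  have bound: "\<bar>s k x\<bar> \<le> C * indicat_real (cball 0 (B + norm e)) x" for k x
  proof (cases "norm x \<le> B + norm e")
    case True
    have "\<exists>t. 0 < t \<and> t < h k \<and>
        w (h k *\<^sub>R e + x) - w (0 *\<^sub>R e + x) = (h k - 0) * w' (t *\<^sub>R e + x) e"
    proof (rule MVT2)
      fix t
      have "((\<lambda>t. w (t *\<^sub>R e + x)) has_derivative (\<lambda>r. w' (t *\<^sub>R e + x) (r *\<^sub>R e))) (at t)"
        by (rule has_derivative_compose[OF _ der]) (auto intro!: derivative_eq_intros)
      moreover have "w' (t *\<^sub>R e + x) (r *\<^sub>R e) = w' (t *\<^sub>R e + x) e * r" for r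
        using linear_scale[OF has_derivative_linear[OF der]] by simp
      ultimately show "((\<lambda>t. w (t *\<^sub>R e + x)) has_real_derivative w' (t *\<^sub>R e + x) e) (at t)"
        by (simp add: has_field_derivative_def)
    qed (use h in auto)
    then obtain t where "w (h k *\<^sub>R e + x) - w x = h k * w' (t *\<^sub>R e + x) e" by auto
    then have "s k x = w' (t *\<^sub>R e + x) e"
      using h(1)[of k] by (simp add: s_def)
    then show ?thesis using True C by simp
  next
    case False
    have "norm (h k *\<^sub>R e) \<le> norm e"
      using h[of k] by (simp add: mult_left_le_one_le)
    then have "B < norm (h k *\<^sub>R e + x)"
      using False norm_diff_ineq[of x "h k *\<^sub>R e"] by (simp add: add.commute)
    moreover have "B < norm x" using False norm_ge_zero[of e] by linarith
    ultimately show ?thesis using False by (simp add: s_def supp)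
  qed
  have lim: "(\<lambda>k. s k x) \<longlonglongrightarrow> w' x e" for x
  proof -
    have "((\<lambda>t. w (x + t *\<^sub>R e)) has_derivative (\<lambda>r. w' (x + 0 *\<^sub>R e) (r *\<^sub>R e))) (at 0)"
      by (rule has_derivative_compose[OF _ der]) (auto intro!: derivative_eq_intros)
    moreover have "w' x (r *\<^sub>R e) = w' x e * r" for r
      using linear_scale[OF has_derivative_linear[OF der]] by simp
    ultimately have "((\<lambda>t. w (x + t *\<^sub>R e)) has_real_derivative w' x e) (at 0)"
      by (simp add: has_field_derivative_def)
    then have "((\<lambda>t. (w (x + t *\<^sub>R e) - w x) / t) \<longlongrightarrow> w' x e) (at 0)"
      by (simp add: has_field_derivative_iff)
    moreover have "filterlim h (at 0) sequentially"
      using hlim h(1) by (auto simp: filterlim_at less_imp_neq[symmetric] intro!: always_eventually)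
    ultimately have "(\<lambda>k. (w (x + h k *\<^sub>R e) - w x) / h k) \<longlonglongrightarrow> w' x e"
      by (rule filterlim_compose)
    then show ?thesis
      unfolding s_def by (simp add: add.commute)
  qed
  have wm: "w \<in> borel_measurable borel"
    by (rule borel_measurable_continuous_onI[OF contw])
  have int: "integrable lebesgue w"
    by (rule integrable_lebesgue_compact_support[OF contw supp])
  have int': "integrable lebesgue (\<lambda>x. w (h k *\<^sub>R e + x))" for k
  proof (rule integrable_lebesgue_compact_support[where B="B + norm e"])
    show "continuous_on UNIV (\<lambda>x. w (h k *\<^sub>R e + x))"
      by (intro continuous_on_compose2[OF contw] continuous_intros) auto
    fix x :: 'a assume "norm x > B + norm e"
    moreover have "norm (h k *\<^sub>R e) \<le> norm e"
      using h[of k] by (simp add: mult_left_le_one_le)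
    ultimately have "B < norm (h k *\<^sub>R e + x)"
      using norm_diff_ineq[of x "h k *\<^sub>R e"] by (simp add: add.commute)
    then show "w (h k *\<^sub>R e + x) = 0" by (rule supp)
  qed
  have "(LINT x|lebesgue. s k x) = 0" for k
    unfolding s_def using int int' by (simp add: integral_lebesgue_translation[OF wm])
  moreover have "(\<lambda>k. LINT x|lebesgue. s k x) \<longlonglongrightarrow> (LINT x|lebesgue. w' x e)"
  proof (rule integral_dominated_convergence)
    show "(\<lambda>x. w' x e) \<in> borel_measurable lebesgue"
      using borel_measurable_continuous_onI[OF cont] by (intro measurable_completion) simp
    show "s k \<in> borel_measurable lebesgue" for k
      unfolding s_def[abs_def] using int int' borel_measurable_integrable by auto
    show "integrable lebesgue (\<lambda>x::'a. C * indicat_real (cball 0 (B + norm e)) x)"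
      using emeasure_bounded_finite[OF bounded_cball[of "0::'a" "B + norm e"]]
      by (auto intro!: integrable_mult_right integrable_real_indicator simp: less_top)
  qed (use bound lim in auto)
  ultimately show ?thesis by (simp add: LIMSEQ_const_iff)
qed

text \<open>Integration by parts: the directional derivative of \<open>f * \<psi>\<close> has
  integral zero over the whole space. Since \<open>\<psi>\<close> has compact support in
  \<open>D\<close>, integrals over \<open>D\<close> and over the space coincide.\<close>

lemma weak_partial_classical:
  fixes f :: "real ^ 'n \<Rightarrow> real"
  assumes D: "open D" "bounded D"
    and der: "\<And>x. (f has_derivative f' x) (at x)"
    and cont: "continuous_on UNIV (\<lambda>x. f' x (axis i 1))"
  shows "weak_partial D i f (\<lambda>x. f' x (axis i 1))"
proof -
  have contf: "continuous_on UNIV f"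
    by (intro continuous_at_imp_continuous_on ballI has_derivative_continuous[OF der])
  have loc: "locally_integrable D g" if "continuous_on UNIV g" for g :: "real ^ 'n \<Rightarrow> real"
    unfolding locally_integrable_def
  proof clarify
    fix K :: "(real ^ 'n) set" assume "compact K"
    then have "integrable lborel (\<lambda>x. indicator K x *\<^sub>R g x)"
      by (intro borel_integrable_compact continuous_on_subset[OF that]) auto
    then have "integrable lebesgue (\<lambda>x. indicator K x *\<^sub>R g x)"
      by (subst integrable_completion) (auto dest: borel_measurable_integrable)
    then show "integrable (lebesgue_on K) g"
      using \<open>compact K\<close> by (subst integrable_restrict_space) (auto simp: compact_imp_closed)
  qed
  have "(LINT x|lebesgue_on D. f x * partial i \<psi> x) = - (LINT x|lebesgue_on D. f' x (axis i 1) * \<psi> x)"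
    if "test_function D \<psi>" for \<psi>
  proof -
    define S where "S = closure {x. \<psi> x \<noteq> 0}"
    have S: "compact S" "S \<subseteq> D" using that by (auto simp: test_function_def S_def)
    have "Ck (Suc 0) \<psi>" using that unfolding test_function_def by blast
    then have d: "\<psi> differentiable (at x)" and c: "continuous_on UNIV (partial i \<psi>)" for x
      by auto
    note dpsi = d[unfolded frechet_derivative_works]
    have contpsi: "continuous_on UNIV \<psi>"
      by (intro continuous_at_imp_continuous_on ballI has_derivative_continuous[OF dpsi])
    have z: "\<psi> x = 0" if "x \<notin> S" for x
      using that closure_subset[of "{x. \<psi> x \<noteq> 0}"] by (auto simp: S_def)
    have z': "partial i \<psi> x = 0" if "x \<notin> S" for x
    proof -
      have "(\<psi> has_derivative (\<lambda>_. 0)) (at x)"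
      proof (rule has_derivative_transform_within_open[OF has_derivative_const])
        show "open (- S)" by (simp add: open_Compl compact_imp_closed S(1))
      qed (use that z in auto)
      then show ?thesis
        using has_derivative_unique[OF dpsi[of x]] by (simp add: partial_def)
    qed
    obtain B where B: "\<And>x. x \<in> S \<Longrightarrow> norm x \<le> B"
      using compact_imp_bounded[OF S(1)] by (auto simp: bounded_iff)
    have restr: "(LINT x|lebesgue_on D. g x) = (LINT x|lebesgue. g x)"
      if "\<And>x. x \<notin> S \<Longrightarrow> g x = 0" for g :: "real ^ 'n \<Rightarrow> real"
    proof -
      have "(LINT x|lebesgue_on D. g x) = (LINT x|lebesgue. indicat_real D x *\<^sub>R g x)"
        using D by (subst integral_restrict_space) auto
      also have "(\<lambda>x. indicat_real D x *\<^sub>R g x) = g"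
        using that S(2) by (auto simp: fun_eq_iff indicator_def)
      finally show ?thesis .
    qed
    have i1: "integrable lebesgue (\<lambda>x. f x * partial i \<psi> x)"
      by (rule integrable_lebesgue_compact_support[where B=B])
         (use B z' in \<open>auto intro!: continuous_intros contf c simp: not_le[symmetric]\<close>)
    have i2: "integrable lebesgue (\<lambda>x. f' x (axis i 1) * \<psi> x)"
      by (rule integrable_lebesgue_compact_support[where B=B])
         (use B z in \<open>auto intro!: continuous_intros cont contpsi simp: not_le[symmetric]\<close>)
    have "(LINT x|lebesgue. f x * frechet_derivative \<psi> (at x) (axis i 1) + f' x (axis i 1) * \<psi> x) = 0"
    proof (rule integral_directional_derivative_eq_0[where w="\<lambda>x. f x * \<psi> x" and B=B and e="axis i 1"
          and w'="\<lambda>x h. f x * frechet_derivative \<psi> (at x) h + f' x h * \<psi> x"])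
      show "((\<lambda>x. f x * \<psi> x) has_derivative
          (\<lambda>h. f x * frechet_derivative \<psi> (at x) h + f' x h * \<psi> x)) (at x)" for x
        by (rule has_derivative_mult[OF der dpsi])
      show "continuous_on UNIV (\<lambda>x. f x * frechet_derivative \<psi> (at x) (axis i 1) + f' x (axis i 1) * \<psi> x)"
        using c contf cont contpsi unfolding partial_def[abs_def] by (intro continuous_intros)
      show "f x * \<psi> x = 0" if "B < norm x" for x
        using that B z by (auto simp: not_le[symmetric])
    qed
    then have "(LINT x|lebesgue. f x * partial i \<psi> x) + (LINT x|lebesgue. f' x (axis i 1) * \<psi> x) = 0"
      using i1 i2 by (simp add: partial_def)
    then show ?thesis
      using z z' by (simp add: restr)
  qed
  then show ?thesis
    using loc[OF contf] loc[OF cont] by (simp add: weak_partial_def)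
qed

text \<open>Continuity on the whole space bounds \<open>f\<close> on a closed ball containing
  \<open>D\<close>; continuity on \<open>D\<close> alone would not.\<close>

lemma in_Lp_continuous:
  fixes f :: "real ^ 'n \<Rightarrow> real"
  assumes D: "open D" "bounded D" and cont: "continuous_on UNIV f"
  shows "in_Lp p D f"
proof -
  obtain B where B: "\<And>x. x \<in> D \<Longrightarrow> norm x \<le> B"
    using D(2) by (auto simp: bounded_iff)
  have "integrable lborel (\<lambda>x. indicator (cball 0 B) x *\<^sub>R \<bar>f x\<bar> ^ p)"
    by (intro borel_integrable_compact continuous_intros continuous_on_subset[OF cont]) auto
  then have "integrable lebesgue (\<lambda>x. indicat_real (cball 0 B) x *\<^sub>R \<bar>f x\<bar> ^ p)"
    by (subst integrable_completion) (auto dest: borel_measurable_integrable)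
  then have "integrable lebesgue (\<lambda>x. indicat_real D x *\<^sub>R indicat_real (cball 0 B) x *\<^sub>R \<bar>f x\<bar> ^ p)"
    using D(1) by (intro integrable_mult_indicator[of D]) auto
  also have "(\<lambda>x. indicat_real D x *\<^sub>R indicat_real (cball 0 B) x *\<^sub>R \<bar>f x\<bar> ^ p) =
      (\<lambda>x. indicat_real D x *\<^sub>R \<bar>f x\<bar> ^ p)"
    using B by (auto simp: fun_eq_iff indicator_def)
  finally have "integrable (lebesgue_on D) (\<lambda>x. \<bar>f x\<bar> ^ p)"
    using D(1) by (subst integrable_restrict_space) auto
  moreover have "f \<in> borel_measurable (lebesgue_on D)"
    using borel_measurable_continuous_onI[OF cont] by (intro measurable_restrict_space1 measurable_completion) simp
  ultimately show ?thesis by (simp add: in_Lp_def)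
qed

lemma sobolev2_classical:
  fixes \<phi> :: "real ^ 'n \<Rightarrow> real" and G :: "real ^ 'n \<Rightarrow> real ^ 'n"
    and H :: "real ^ 'n \<Rightarrow> real ^ 'n ^ 'n"
  assumes D: "open D" "bounded D"
    and d1: "\<And>x. (\<phi> has_derivative (\<lambda>h. G x \<bullet> h)) (at x)"
    and d2: "\<And>x i. ((\<lambda>x. G x $ i) has_derivative (\<lambda>h. H x $ i \<bullet> h)) (at x)"
    and cont: "\<And>i j. continuous_on UNIV (\<lambda>x. H x $ i $ j)"
  shows "sobolev2 p D \<phi> G H"
proof -
  have c1: "continuous_on UNIV \<phi>"
    by (intro continuous_at_imp_continuous_on ballI has_derivative_continuous[OF d1])
  have c2: "continuous_on UNIV (\<lambda>x. G x $ i)" for i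
    by (intro continuous_at_imp_continuous_on ballI has_derivative_continuous[OF d2])
  have "weak_partial D i \<phi> (\<lambda>x. G x $ i)" for i
    using weak_partial_classical[OF D d1, of i] c2 by (simp add: inner_axis)
  moreover have "weak_partial D j (\<lambda>x. G x $ i) (\<lambda>x. H x $ i $ j)" for i j
    using weak_partial_classical[OF D d2, of i j] cont by (simp add: inner_axis)
  ultimately show ?thesis
    unfolding sobolev2_def using in_Lp_continuous[OF D] c1 c2 cont by blast
qed

section \<open>Comparison with Gaussian barriers\<close>

definition gauss :: "real \<Rightarrow> real ^ 'n \<Rightarrow> real ^ 'n \<Rightarrow> real" where
  "gauss \<alpha> z x = exp (- \<alpha> * ((x - z) \<bullet> (x - z)))"

lemma gauss_has_derivative:
  "(gauss \<alpha> z has_derivative (\<lambda>h. - 2 * \<alpha> * gauss \<alpha> z x * ((x - z) \<bullet> h))) (at x)"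
  unfolding gauss_def
  by (auto intro!: derivative_eq_intros simp: inner_commute algebra_simps)

lemma continuous_on_gauss [continuous_intros]:
  fixes f :: "'a::topological_space \<Rightarrow> real ^ 'n"
  shows "continuous_on S f \<Longrightarrow> continuous_on S (\<lambda>x. gauss \<alpha> z (f x))"
  unfolding gauss_def by (intro continuous_intros)

text \<open>This is the only shape of test function that occurs. The affine majorant leaves no trace
  in the Hessian, and \<open>e\<close> will be the value of the Gaussian on the outer sphere of the
  annulus.\<close>

lemma sobolev2_gauss:
  fixes a z :: "real ^ 'n"
  assumes "open D" "bounded D"
  shows "sobolev2 p D (\<lambda>x. a \<bullet> x + b - K * (gauss \<alpha> z x - e))
    (\<lambda>x. a + (2 * \<alpha> * K * gauss \<alpha> z x) *\<^sub>R (x - z))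
    (\<lambda>x. rank1_pert (2 * \<alpha> * K * gauss \<alpha> z x) (- 4 * \<alpha>\<^sup>2 * K * gauss \<alpha> z x) (x - z))"
proof (rule sobolev2_classical[OF assms])
  show "((\<lambda>x. a \<bullet> x + b - K * (gauss \<alpha> z x - e)) has_derivative
      (\<bullet>) (a + (2 * \<alpha> * K * gauss \<alpha> z x) *\<^sub>R (x - z))) (at x)" for x
    by (auto intro!: derivative_eq_intros gauss_has_derivative simp: fun_eq_iff algebra_simps)
  show "((\<lambda>x. (a + (2 * \<alpha> * K * gauss \<alpha> z x) *\<^sub>R (x - z)) $ i) has_derivative
      (\<bullet>) (rank1_pert (2 * \<alpha> * K * gauss \<alpha> z x) (- 4 * \<alpha>\<^sup>2 * K * gauss \<alpha> z x) (x - z) $ i)) (at x)"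
    for x i
  proof -
    have "((\<lambda>x. a $ i + (2 * \<alpha> * K * gauss \<alpha> z x) * (x $ i - z $ i)) has_derivative
        (\<lambda>h. (2 * \<alpha> * K * gauss \<alpha> z x) * h $ i +
          (2 * \<alpha> * K * (- 2 * \<alpha> * gauss \<alpha> z x * ((x - z) \<bullet> h))) * (x $ i - z $ i))) (at x)"
      by (auto intro!: derivative_eq_intros gauss_has_derivative bounded_linear_imp_has_derivative
          bounded_linear_vec_nth simp: fun_eq_iff algebra_simps)
    moreover have "rank1_pert c d y $ i \<bullet> h = c * h $ i + d * y $ i * (y \<bullet> h)"
      for c d and y h :: "real ^ 'n"
    proof -
      have "rank1_pert c d y $ i \<bullet> h =
          (\<Sum>j\<in>UNIV. (if i = j then c * h $ i else 0) + d * y $ i * (y $ j * h $ j))"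
        unfolding inner_vec_def by (rule sum.cong) (auto simp: rank1_pert_def algebra_simps)
      then show ?thesis
        by (simp add: sum.distrib inner_vec_def flip: sum_distrib_left)
    qed
    then have "(\<bullet>) (rank1_pert (2 * \<alpha> * K * gauss \<alpha> z x) (- 4 * \<alpha>\<^sup>2 * K * gauss \<alpha> z x) (x - z) $ i) =
        (\<lambda>h. (2 * \<alpha> * K * gauss \<alpha> z x) * h $ i +
          (2 * \<alpha> * K * (- 2 * \<alpha> * gauss \<alpha> z x * ((x - z) \<bullet> h))) * (x $ i - z $ i))"
      by (simp add: fun_eq_iff power2_eq_square)
    ultimately show ?thesis by simp
  qed
  show "continuous_on UNIV (\<lambda>x. rank1_pert (2 * \<alpha> * K * gauss \<alpha> z x)
      (- 4 * \<alpha>\<^sup>2 * K * gauss \<alpha> z x) (x - z) $ i $ j)" for i j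
    unfolding rank1_pert_def vec_lambda_beta by (cases "i = j") (auto intro!: continuous_intros)
qed

text \<open>At distance q from \<open>z\<close> the Pucci operator of the Hessian is a positive
  factor times the bracket \<open>Lam * (n - 1) + lam - 2 * \<alpha> * lam * q^2\<close>, which the
  hypothesis on \<rho> makes negative for q \<ge> \<rho>. A uniform negative bound near
  \<open>x0\<close> contradicts the subsolution property at a touching point.\<close>

lemma gauss_not_touching_subsolution:
  fixes a z x0 :: "real ^ 'n"
  assumes D: "open D" "bounded D" and sub: "pucci_subsolution lam Lam D u"
    and lam: "0 < lam" "0 \<le> Lam" and \<alpha>: "0 < \<alpha>"
    and \<rho>: "0 < \<rho>" "Lam * (real CARD('n) - 1) + lam < 2 * \<alpha> * \<rho>\<^sup>2 * lam"
    and K: "0 < K" and x0: "x0 \<in> D" "\<rho> < dist x0 z" "dist x0 z < R"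
    and max: "\<forall>\<^sub>F y in at x0 within D.
      u y - (a \<bullet> y + b - K * (gauss \<alpha> z y - e)) \<le> u x0 - (a \<bullet> x0 + b - K * (gauss \<alpha> z x0 - e))"
  shows False
proof -
  define H where "H x = rank1_pert (2 * \<alpha> * K * gauss \<alpha> z x) (- 4 * \<alpha>\<^sup>2 * K * gauss \<alpha> z x) (x - z)" for x
  define P where "P x = 2 * \<alpha> * K * gauss \<alpha> z x *
    (Lam * (real CARD('n) - 1) + lam - 2 * \<alpha> * lam * ((x - z) \<bullet> (x - z)))" for x
  define s where "s = 2 * \<alpha> * \<rho>\<^sup>2 * lam - (Lam * (real CARD('n) - 1) + lam)"
  \<comment> \<open>\<open>exp (- \<alpha> * R\<^sup>2)\<close> bounds the Gaussian from below on
    the annulus, and \<open>s\<close> is the size of the bracket at radius \<rho>.\<close>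
  define \<epsilon> where "\<epsilon> = 2 * \<alpha> * K * exp (- \<alpha> * R\<^sup>2) * s"
  have s: "0 < s" using \<rho> by (simp add: s_def)
  have \<epsilon>: "0 < \<epsilon>" using s \<alpha> K by (simp add: \<epsilon>_def)
  have n1: "real (CARD('n) - 1) = real CARD('n) - 1"
    by (simp add: of_nat_diff Suc_le_eq)
  \<comment> \<open>The same hypothesis on \<rho> makes the radial eigenvalue negative, because the
    term with \<open>Lam\<close> is nonnegative.\<close>
  have "0 \<le> Lam * (real CARD('n) - 1)" using lam n1[symmetric] by simp
  then have "lam * 1 < lam * (2 * \<alpha> * \<rho>\<^sup>2)" using \<rho>(2) by (simp add: mult.commute)
  then have \<rho>1: "1 < 2 * \<alpha> * \<rho>\<^sup>2" using lam(1) mult_less_cancel_left_pos by blast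
  have ann: "pucci_max lam Lam (H x) = P x \<and> P x \<le> - \<epsilon>"
    if "\<rho> < dist x z" "dist x z < R" for x
  proof
    define q where "q = (x - z) \<bullet> (x - z)"
    have q: "q = (dist x z)\<^sup>2" by (simp add: q_def dist_norm power2_norm_eq_inner)
    have q1: "\<rho>\<^sup>2 \<le> q" "q \<le> R\<^sup>2"
      unfolding q using that \<rho>(1) by (auto intro!: power_mono)
    have "2 * \<alpha> * \<rho>\<^sup>2 \<le> 2 * \<alpha> * q" using q1 \<alpha> by simp
    then have "1 - 2 * \<alpha> * q < 0" using \<rho>1 by linarith
    then have neg: "2 * \<alpha> * K * gauss \<alpha> z x * (1 - 2 * \<alpha> * q) < 0"
      using \<alpha> K by (intro mult_pos_neg) (auto simp: gauss_def)
    show "pucci_max lam Lam (H x) = P x"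
      unfolding H_def
      using neg \<alpha> K
      by (subst pucci_max_rank1_pert)
         (auto simp: gauss_def P_def n1 q_def power2_eq_square algebra_simps)
    have "2 * \<alpha> * lam * \<rho>\<^sup>2 \<le> 2 * \<alpha> * lam * q"
      using q1 \<alpha> lam by simp
    then have "s \<le> - (Lam * (real CARD('n) - 1) + lam - 2 * \<alpha> * lam * q)"
      by (simp add: s_def algebra_simps)
    moreover have "exp (- \<alpha> * R\<^sup>2) \<le> gauss \<alpha> z x"
      using q1 \<alpha> by (simp add: gauss_def q_def)
    ultimately have "2 * \<alpha> * K * exp (- \<alpha> * R\<^sup>2) * s \<le>
        2 * \<alpha> * K * gauss \<alpha> z x * (- (Lam * (real CARD('n) - 1) + lam - 2 * \<alpha> * lam * q))"
      using s \<alpha> K by (intro mult_mono) (auto simp: gauss_def)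
    then show "P x \<le> - \<epsilon>"
      unfolding P_def \<epsilon>_def q_def[symmetric] by linarith
  qed
  have "open (D \<inter> (ball z R - cball z \<rho>))"
    using D by (intro open_Int open_Diff) auto
  moreover have "x0 \<in> D \<inter> (ball z R - cball z \<rho>)"
    using x0 by (auto simp: dist_commute)
  ultimately obtain r where r: "0 < r" "ball x0 r \<subseteq> D \<inter> (ball z R - cball z \<rho>)"
    by (meson open_contains_ball)
  have in_ann: "\<rho> < dist x z \<and> dist x z < R" if "x \<in> D \<inter> ball x0 r" for x
    using that subsetD[OF r(2), of x] by (auto simp: dist_commute)
  have "continuous_on UNIV P"
    unfolding P_def by (intro continuous_intros)
  then have meas: "P \<in> borel_measurable (lebesgue_on A)" for A
    by (intro measurable_restrict_space1 measurable_completion) (simp add: borel_measurable_continuous_onI)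
  \<comment> \<open>Bounding \<open>esssup\<close> from above requires measurability, which is not
    evident for a function defined through \<open>eigenvalues\<close>; on the small ball it agrees
    with the continuous \<open>P\<close>.\<close>
  have "(\<lambda>y. ereal (pucci_max lam Lam (H y))) \<in> borel_measurable (lebesgue_on (D \<inter> ball x0 r))"
  proof (subst measurable_cong)
    show "ereal (pucci_max lam Lam (H y)) = ereal (P y)"
      if "y \<in> space (lebesgue_on (D \<inter> ball x0 r))" for y
      using that ann in_ann by simp
    show "(\<lambda>y. ereal (P y)) \<in> borel_measurable (lebesgue_on (D \<inter> ball x0 r))"
      using meas by simp
  qed
  then have "esssup (lebesgue_on (D \<inter> ball x0 r)) (\<lambda>y. ereal (pucci_max lam Lam (H y))) \<le> ereal (- \<epsilon>)"
    by (rule esssup_I) (use ann in_ann in \<open>auto intro!: AE_I2\<close>)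
  then have "ess_limsup_at D x0 (\<lambda>y. pucci_max lam Lam (H y)) \<le> ereal (- \<epsilon>)"
    unfolding ess_limsup_at_def using r(1) by (intro INF_lower2) auto
  moreover have "0 \<le> ess_limsup_at D x0 (\<lambda>y. pucci_max lam Lam (H y))"
  proof -
    have "continuous_on D (\<lambda>x. a \<bullet> x + b - K * (gauss \<alpha> z x - e))"
      by (intro continuous_intros)
    with sub sobolev2_gauss[OF D, of "CARD('n)" a b K \<alpha> z e] max x0(1) show ?thesis
      unfolding pucci_subsolution_def H_def[symmetric] by blast
  qed
  ultimately have "0 \<le> ereal (- \<epsilon>)" by (rule order_trans[rotated])
  then show False using \<epsilon> by simp
qed

lemma gauss_comparison:
  fixes a z :: "real ^ 'n"
  assumes \<Omega>: "open \<Omega>" and cont: "continuous_on (closure \<Omega> \<inter> ball 0 1) u"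
    and sub: "pucci_subsolution lam Lam (\<Omega> \<inter> ball 0 1) u"
    and lam: "0 < lam" "0 \<le> Lam" and \<alpha>: "0 < \<alpha>"
    and \<rho>: "0 < \<rho>" "Lam * (real CARD('n) - 1) + lam < 2 * \<alpha> * \<rho>\<^sup>2 * lam"
    and K: "0 \<le> K" and ball: "cball z R \<subseteq> ball 0 1"
    and le: "\<And>x. x \<in> \<Omega> \<Longrightarrow> dist x z \<le> R \<Longrightarrow> u x \<le> a \<bullet> x + b"
    and hole: "\<And>x. x \<in> \<Omega> \<Longrightarrow> dist x z \<le> \<rho> \<Longrightarrow>
      u x \<le> a \<bullet> x + b - K * (gauss \<alpha> z x - exp (- \<alpha> * R\<^sup>2))"
    and bdry: "\<And>x. x \<in> frontier \<Omega> \<Longrightarrow> \<rho> \<le> dist x z \<Longrightarrow> dist x z \<le> R \<Longrightarrow>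
      u x \<le> a \<bullet> x + b - K * (gauss \<alpha> z x - exp (- \<alpha> * R\<^sup>2))"
    and x: "x \<in> \<Omega>" "dist x z \<le> R"
  shows "u x \<le> a \<bullet> x + b - K * (gauss \<alpha> z x - exp (- \<alpha> * R\<^sup>2))"
proof (rule ccontr)
  define \<phi> where "\<phi> y = a \<bullet> y + b - K * (gauss \<alpha> z y - exp (- \<alpha> * R\<^sup>2))" for y
  define S where "S = closure \<Omega> \<inter> (cball z R - ball z \<rho>)"
  assume "\<not> ?thesis"
  then have x1: "u x - \<phi> x > 0" by (simp add: \<phi>_def)
  then have "K \<noteq> 0" using le[OF x] by (auto simp: \<phi>_def)
  with K have K: "0 < K" by simp
  have "\<not> dist x z \<le> \<rho>" using hole[OF x(1)] x1 by (auto simp: \<phi>_def)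
  then have xS: "x \<in> S" using x closure_subset[of \<Omega>] by (auto simp: S_def dist_commute)
  have "compact S" unfolding S_def
    by (intro closed_Int_compact compact_diff) auto
  moreover have "continuous_on S (\<lambda>y. u y - \<phi> y)"
    unfolding \<phi>_def
    by (intro continuous_intros continuous_on_subset[OF cont]) (use ball in \<open>auto simp: S_def\<close>)
  ultimately obtain x0 where x0: "x0 \<in> S" "\<And>y. y \<in> S \<Longrightarrow> u y - \<phi> y \<le> u x0 - \<phi> x0"
    using continuous_attains_sup[of S "\<lambda>y. u y - \<phi> y"] xS by blast
  have pos: "0 < u x0 - \<phi> x0" using x0(2)[OF xS] x1 by linarith
  have d: "\<rho> \<le> dist x0 z" "dist x0 z \<le> R" using x0(1) by (auto simp: S_def dist_commute)
  have "x0 \<notin> frontier \<Omega>" using bdry[OF _ d] pos by (auto simp: \<phi>_def)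
  then have x0\<Omega>: "x0 \<in> \<Omega>"
    using x0(1) interior_open[OF \<Omega>] by (auto simp: S_def frontier_def)
  have "dist x0 z \<noteq> \<rho>" using hole[OF x0\<Omega>] pos by (auto simp: \<phi>_def)
  moreover have "dist x0 z \<noteq> R"
  proof
    assume "dist x0 z = R"
    then have "gauss \<alpha> z x0 = exp (- \<alpha> * R\<^sup>2)"
      by (simp add: gauss_def dist_norm power2_norm_eq_inner[symmetric])
    then show False using le[OF x0\<Omega> d(2)] pos by (simp add: \<phi>_def)
  qed
  ultimately have d': "\<rho> < dist x0 z" "dist x0 z < R" using d by auto
  have D: "open (\<Omega> \<inter> ball 0 1)" "bounded (\<Omega> \<inter> ball 0 1)"
    using \<Omega> by (auto intro: bounded_subset[OF bounded_ball])
  have x0D: "x0 \<in> \<Omega> \<inter> ball 0 1"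
    using x0\<Omega> d(2) ball by (auto simp: dist_commute subset_eq)
  have "open (\<Omega> \<inter> (ball z R - cball z \<rho>))"
    using \<Omega> by (intro open_Int open_Diff) auto
  moreover have "x0 \<in> \<Omega> \<inter> (ball z R - cball z \<rho>)"
    using d' x0\<Omega> by (auto simp: dist_commute)
  ultimately have "\<forall>\<^sub>F y in at x0 within \<Omega> \<inter> ball 0 1. y \<in> \<Omega> \<inter> (ball z R - cball z \<rho>)"
    by (auto simp: eventually_at_topological)
  then have "\<forall>\<^sub>F y in at x0 within \<Omega> \<inter> ball 0 1. u y - \<phi> y \<le> u x0 - \<phi> x0"
    by eventually_elim (rule x0(2), use closure_subset[of \<Omega>] in \<open>auto simp: S_def\<close>)
  then show False
    using gauss_not_touching_subsolution[OF D sub lam \<alpha> \<rho> K x0D d'] unfolding \<phi>_def by blast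
qed

section \<open>Gain in one step\<close>

lemma exp_diff_upper:
  fixes \<alpha> s S m :: real
  assumes "0 \<le> \<alpha>" "0 \<le> s" "S - s \<le> m" "0 \<le> m"
  shows "exp (- \<alpha> * s) - exp (- \<alpha> * S) \<le> \<alpha> * m"
\<comment> \<open>For \<open>s \<le> S\<close> the factor
  \<open>exp (- \<alpha> * s) \<le> 1\<close> splits off; otherwise the left side is at most 0,
  which is why \<open>m\<close> has to be nonnegative.\<close>
proof (cases "s \<le> S")
  case True
  have "exp (- \<alpha> * S) = exp (- \<alpha> * s) * exp (- \<alpha> * (S - s))"
    by (simp add: algebra_simps flip: exp_add)
  moreover have "1 - \<alpha> * (S - s) \<le> exp (- \<alpha> * (S - s))"
    using exp_ge_add_one_self[of "- \<alpha> * (S - s)"] by simp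
  ultimately have "exp (- \<alpha> * s) - exp (- \<alpha> * S) \<le> exp (- \<alpha> * s) * (\<alpha> * (S - s))"
    using mult_left_mono[of "1 - \<alpha> * (S - s)" "exp (- \<alpha> * (S - s))" "exp (- \<alpha> * s)"]
    by (simp add: algebra_simps)
  also have "\<dots> \<le> 1 * (\<alpha> * m)"
    using assms True by (intro mult_mono) auto
  finally show ?thesis by simp
next
  case False
  then have "exp (- \<alpha> * s) \<le> exp (- \<alpha> * S)" using assms by (simp add: mult_left_mono)
  then show ?thesis using assms mult_nonneg_nonneg[of \<alpha> m] by linarith
qed

text \<open>The tangent line at \<open>S\<close> lies below the convex exponential, whatever the
  signs.\<close>

lemma exp_diff_lower:
  fixes \<alpha> s S :: real
  shows "exp (- \<alpha> * S) * (\<alpha> * (S - s)) \<le> exp (- \<alpha> * s) - exp (- \<alpha> * S)"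
proof -
  have "exp (- \<alpha> * s) = exp (- \<alpha> * S) * exp (\<alpha> * (S - s))"
    by (simp add: algebra_simps flip: exp_add)
  moreover have "1 + \<alpha> * (S - s) \<le> exp (\<alpha> * (S - s))"
    by (rule exp_ge_add_one_self)
  ultimately show ?thesis
    using mult_left_mono[of "1 + \<alpha> * (S - s)" "exp (\<alpha> * (S - s))" "exp (- \<alpha> * S)"]
    by (simp add: algebra_simps)
qed

text \<open>The first entry is the barrier of a ball of radius 35/2 read off at radius 17, with 289
  = 17^2. The cap \<open>1 / (26 * \<alpha>)\<close> keeps the next barrier, on a tangent ball of
  radius 13, below the linear majorant on the frontier.\<close>

definition bump_const :: "real \<Rightarrow> real" where
  "bump_const \<alpha> = min (exp (- \<alpha> * 289) - exp (- \<alpha> * (35/2)\<^sup>2)) (1 / (26 * \<alpha>))"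

text \<open>The barrier of a ball of radius 13 read off at radius 25/2, with the same cap for the
  last tangent ball.\<close>

definition tangent_const :: "real \<Rightarrow> real" where
  "tangent_const \<alpha> =
     min (bump_const \<alpha> * (exp (- \<alpha> * (25/2)\<^sup>2) - exp (- \<alpha> * 169))) (1 / (26 * \<alpha>))"

text \<open>At depth h \<le> 1 inside the tangent ball of radius 13 the barrier is at least
  \<open>exp (- \<alpha> * 169) * \<alpha> * 13 * h\<close>, since 169 - (13 - h)^2 \<ge> 13
  h.\<close>

definition decay_const :: "real \<Rightarrow> real" where
  "decay_const \<alpha> = 13 * \<alpha> * exp (- \<alpha> * 169) * tangent_const \<alpha>"

text \<open>The denominator is the drop of the Gaussian between radii 1 and 2. The factor 15 is 3 *
  5: (1 + h)^2 - 1 \<le> 3 h for 0 \<le> h \<le> 1, and lengths are measured in units of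
  1/5.\<close>

definition linear_const :: "real \<Rightarrow> real" where
  "linear_const \<alpha> = 15 * \<alpha> / (exp (- \<alpha>) - exp (- \<alpha> * 4))"

lemma bump_const_pos: "0 < \<alpha> \<Longrightarrow> 0 < bump_const \<alpha>"
  by (simp add: bump_const_def power2_eq_square)

lemma tangent_const_pos: "0 < \<alpha> \<Longrightarrow> 0 < tangent_const \<alpha>"
  using bump_const_pos[of \<alpha>] by (simp add: tangent_const_def power2_eq_square)

lemma decay_const_pos: "0 < \<alpha> \<Longrightarrow> 0 < decay_const \<alpha>"
  using tangent_const_pos[of \<alpha>] by (simp add: decay_const_def)

lemma decay_const_le: "0 < \<alpha> \<Longrightarrow> decay_const \<alpha> \<le> 1"
proof -
  assume \<alpha>: "0 < \<alpha>"
  have "decay_const \<alpha> \<le> 13 * \<alpha> * 1 * (1 / (26 * \<alpha>))"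
    unfolding decay_const_def using \<alpha> tangent_const_pos[of \<alpha>]
    by (intro mult_mono) (auto simp: tangent_const_def)
  then show ?thesis using \<alpha> by simp
qed

lemma linear_const_pos: "0 < \<alpha> \<Longrightarrow> 0 < linear_const \<alpha>"
  by (simp add: linear_const_def)

text \<open>A coordinate-free setting: \<nu> is the direction of the last axis, and subtracting the
  component along it gives the tangential part. The second bound on \<alpha> is the negativity
  condition \<open>2 * \<alpha> * \<rho>\<^sup>2 * lam\<close> at \<rho> = 1/4, the smallest inner
  radius.\<close>

locale pucci_subsolution_above_graph =
  fixes \<Omega> :: "(real ^ 'n) set" and u :: "real ^ 'n \<Rightarrow> real" and lam Lam \<alpha> :: real
    and \<omega> :: "real \<Rightarrow> real" and \<nu> :: "real ^ 'n"
  assumes open_\<Omega>: "open \<Omega>"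
    and cont: "continuous_on (closure \<Omega> \<inter> ball 0 1) u"
    and sub: "pucci_subsolution lam Lam (\<Omega> \<inter> ball 0 1) u"
    and lam: "0 < lam" "0 \<le> Lam"
    and \<alpha>: "0 < \<alpha>" "Lam * (real CARD('n) - 1) + lam < \<alpha> * lam / 8"
    and bdry: "\<And>x. x \<in> frontier \<Omega> \<Longrightarrow> norm x < 1 \<Longrightarrow> u x \<le> 0"
    and mono: "mono_on {0..} \<omega>"
    and nonneg: "\<And>r. 0 \<le> r \<Longrightarrow> 0 \<le> \<omega> r"
    and norm_\<nu>: "norm \<nu> = 1"
    and below: "\<And>x. norm x < 1 \<Longrightarrow>
      \<nu> \<bullet> x \<le> norm (x - (\<nu> \<bullet> x) *\<^sub>R \<nu>) * \<omega> (norm (x - (\<nu> \<bullet> x) *\<^sub>R \<nu>)) \<Longrightarrow> x \<notin> \<Omega>"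
begin

section \<open>Heights of points of the domain and of its closure\<close>

lemma \<nu>_inner_\<nu>: "\<nu> \<bullet> \<nu> = 1"
  using norm_\<nu> by (simp add: norm_eq_1)

lemma height_pos: "x \<in> \<Omega> \<Longrightarrow> norm x < 1 \<Longrightarrow> 0 < \<nu> \<bullet> x"
  using below[of x] nonneg[of "norm (x - (\<nu> \<bullet> x) *\<^sub>R \<nu>)"]
  by (meson linorder_not_le mult_nonneg_nonneg norm_ge_zero order_trans)

lemma norm_tangential_le: "norm (x - (\<nu> \<bullet> x) *\<^sub>R \<nu>) \<le> norm x"
proof (rule power2_le_imp_le)
  show "(norm (x - (\<nu> \<bullet> x) *\<^sub>R \<nu>))\<^sup>2 \<le> (norm x)\<^sup>2"
    unfolding power2_norm_eq_inner by (simp add: inner_simps \<nu>_inner_\<nu> inner_commute)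
qed simp

lemma closure_height_nonneg:
  assumes "x \<in> closure \<Omega>" "norm x < 1"
  shows "0 \<le> \<nu> \<bullet> x"
proof (rule ccontr)
  assume "\<not> ?thesis"
  moreover have "open {y. \<nu> \<bullet> y < 0 \<and> norm y < 1}"
    by (intro open_Collect_conj open_Collect_less continuous_intros)
  moreover have "x \<in> {y. \<nu> \<bullet> y < 0 \<and> norm y < 1} \<inter> closure \<Omega>"
    using assms calculation(1) by auto
  ultimately have "{y. \<nu> \<bullet> y < 0 \<and> norm y < 1} \<inter> \<Omega> \<noteq> {}"
    using open_Int_closure_eq_empty by blast
  then obtain y where "y \<in> \<Omega>" "\<nu> \<bullet> y < 0" "norm y < 1" by auto
  then show False using height_pos[of y] by simp
qed

text \<open>As \<omega> is monotone but possibly discontinuous, the graph inequality need not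
  survive at the limit point itself. The strict gap between \<open>s\<close> and the tangential
  length leaves room for nearby points of \<Omega>, and monotonicity transfers their bound to
  \<open>s\<close>.\<close>

lemma closure_height_ge:
  assumes "x \<in> closure \<Omega>" "norm x < 1" "0 \<le> s" "s < norm (x - (\<nu> \<bullet> x) *\<^sub>R \<nu>)"
  shows "s * \<omega> s \<le> \<nu> \<bullet> x"
proof (rule ccontr)
  let ?U = "{y. \<nu> \<bullet> y < s * \<omega> s \<and> norm y < 1 \<and> s < norm (y - (\<nu> \<bullet> y) *\<^sub>R \<nu>)}"
  assume "\<not> ?thesis"
  moreover have "open ?U"
    by (intro open_Collect_conj open_Collect_less continuous_intros)
  moreover have "x \<in> ?U \<inter> closure \<Omega>"
    using assms calculation(1) by auto
  ultimately have "?U \<inter> \<Omega> \<noteq> {}"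
    using open_Int_closure_eq_empty by blast
  then obtain y where y: "y \<in> \<Omega>" "\<nu> \<bullet> y < s * \<omega> s" "norm y < 1"
      "s < norm (y - (\<nu> \<bullet> y) *\<^sub>R \<nu>)" by auto
  have "s * \<omega> s \<le> norm (y - (\<nu> \<bullet> y) *\<^sub>R \<nu>) * \<omega> (norm (y - (\<nu> \<bullet> y) *\<^sub>R \<nu>))"
    using y assms(3) nonneg by (intro mult_mono mono_onD[OF mono]) auto
  then show False using below[of y] y by auto
qed

text \<open>The exponent \<open>\<alpha> / d\<^sup>2\<close> makes the barrier depend on
  \<open>dist x z / d\<close> only, so the negativity condition becomes independent of the scale. On
  the frontier u \<le> 0 reduces the comparison to a numerical inequality.\<close>

lemma scaled_comparison:
  assumes d: "0 < d" and \<rho>: "1/4 \<le> \<rho>" and K: "0 \<le> K" and ball: "norm z + d * R < 1"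
    and le: "\<And>x. x \<in> \<Omega> \<Longrightarrow> dist x z \<le> d * R \<Longrightarrow> u x \<le> a * (\<nu> \<bullet> x) + b"
    and hole: "\<And>x. x \<in> \<Omega> \<Longrightarrow> dist x z \<le> d * \<rho> \<Longrightarrow>
      u x \<le> a * (\<nu> \<bullet> x) + b - K * (exp (- \<alpha> * (dist x z / d)\<^sup>2) - exp (- \<alpha> * R\<^sup>2))"
    and bd: "\<And>x. x \<in> frontier \<Omega> \<Longrightarrow> d * \<rho> \<le> dist x z \<Longrightarrow> dist x z \<le> d * R \<Longrightarrow>
      K * (exp (- \<alpha> * (dist x z / d)\<^sup>2) - exp (- \<alpha> * R\<^sup>2)) \<le> a * (\<nu> \<bullet> x) + b"
    and x: "x \<in> \<Omega>" "dist x z \<le> d * R"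
  shows "u x \<le> a * (\<nu> \<bullet> x) + b - K * (exp (- \<alpha> * (dist x z / d)\<^sup>2) - exp (- \<alpha> * R\<^sup>2))"
proof -
  have g: "gauss (\<alpha> / d\<^sup>2) z y = exp (- \<alpha> * (dist y z / d)\<^sup>2)" for y
    by (simp add: gauss_def dist_norm power2_norm_eq_inner power_divide)
  have e: "exp (- (\<alpha> / d\<^sup>2) * (d * R)\<^sup>2) = exp (- \<alpha> * R\<^sup>2)"
    using d by (simp add: power_mult_distrib)
  have in_ball: "norm y < 1" if "dist y z \<le> d * R" for y
    using that ball norm_triangle_sub[of y z] by (simp add: dist_norm)
  have "(1/4)\<^sup>2 \<le> \<rho>\<^sup>2" using \<rho> by (intro power_mono) auto
  then have "2 * \<alpha> * lam * (1/4)\<^sup>2 \<le> 2 * \<alpha> * lam * \<rho>\<^sup>2"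
    using \<alpha> lam by (intro mult_left_mono) auto
  then have "\<alpha> * lam / 8 \<le> 2 * (\<alpha> / d\<^sup>2) * (d * \<rho>)\<^sup>2 * lam"
    using d by (simp add: power_mult_distrib power2_eq_square algebra_simps)
  then have strict: "Lam * (real CARD('n) - 1) + lam < 2 * (\<alpha> / d\<^sup>2) * (d * \<rho>)\<^sup>2 * lam"
    using \<alpha> by linarith
  have "u x \<le> (a *\<^sub>R \<nu>) \<bullet> x + b - K * (gauss (\<alpha> / d\<^sup>2) z x - exp (- (\<alpha> / d\<^sup>2) * (d * R)\<^sup>2))"
  proof (rule gauss_comparison[OF open_\<Omega> cont sub lam _ _ strict K _ _ _ _ x])
    show "cball z (d * R) \<subseteq> ball 0 1" using in_ball by (auto simp: dist_commute)
    show "u y \<le> (a *\<^sub>R \<nu>) \<bullet> y + b - K * (gauss (\<alpha> / d\<^sup>2) z y - exp (- (\<alpha> / d\<^sup>2) * (d * R)\<^sup>2))"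
      if "y \<in> frontier \<Omega>" "d * \<rho> \<le> dist y z" "dist y z \<le> d * R" for y
      using bd[OF that] bdry[OF that(1) in_ball[OF that(3)]] unfolding g e by simp
    show "u y \<le> (a *\<^sub>R \<nu>) \<bullet> y + b - K * (gauss (\<alpha> / d\<^sup>2) z y - exp (- (\<alpha> / d\<^sup>2) * (d * R)\<^sup>2))"
      if "y \<in> \<Omega>" "dist y z \<le> d * \<rho>" for y
      using hole[OF that] unfolding g e by simp
    show "u y \<le> (a *\<^sub>R \<nu>) \<bullet> y + b" if "y \<in> \<Omega>" "dist y z \<le> d * R" for y
      using le[OF that] by simp
  qed (use \<alpha> d \<rho> in auto)
  then show ?thesis unfolding g e by simp
qed

text \<open>The ball is tangent to the hyperplane \<open>\<nu> \<bullet> x = 0\<close>, so on it the barrier is at most a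
  multiple of the height, and the comparison on \<^term>\<open>frontier \<Omega>\<close> holds automatically.\<close>

lemma tangent_ball_comparison:
  assumes d: "0 < d" "40 * d \<le> 1" and a: "0 \<le> a" and \<rho>: "1/4 \<le> \<rho>"
    and m: "0 \<le> m" "m * (26 * \<alpha>) \<le> a * d"
    and le: "\<And>x. x \<in> \<Omega> \<Longrightarrow> norm x < 40 * d \<Longrightarrow> u x \<le> a * (\<nu> \<bullet> x)"
    and z: "\<nu> \<bullet> z = 13 * d" "norm z \<le> 25 * d"
    and hole: "\<And>x. x \<in> \<Omega> \<Longrightarrow> dist x z \<le> d * \<rho> \<Longrightarrow> u x \<le> a * (\<nu> \<bullet> x) - m"
    and x: "x \<in> \<Omega>" "dist x z \<le> d * 13"
  shows "u x \<le> a * (\<nu> \<bullet> x) - m * (exp (- \<alpha> * (dist x z / d)\<^sup>2) - exp (- \<alpha> * 169))"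
proof -
  have small: "norm y < 40 * d" if "dist y z \<le> d * 13" for y
    using that z(2) d norm_triangle_sub[of y z] by (simp add: dist_norm)
  have "u x \<le> a * (\<nu> \<bullet> x) + 0 - m * (exp (- \<alpha> * (dist x z / d)\<^sup>2) - exp (- \<alpha> * 13\<^sup>2))"
  proof (rule scaled_comparison[OF d(1) \<rho> m(1) _ _ _ _ x])
    show "norm z + d * 13 < 1" using z d by simp
    show "u y \<le> a * (\<nu> \<bullet> y) + 0" if "y \<in> \<Omega>" "dist y z \<le> d * 13" for y
      using le[OF that(1) small[OF that(2)]] by simp
    show "u y \<le> a * (\<nu> \<bullet> y) + 0 - m * (exp (- \<alpha> * (dist y z / d)\<^sup>2) - exp (- \<alpha> * 13\<^sup>2))"
      if "y \<in> \<Omega>" "dist y z \<le> d * \<rho>" for y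
    proof -
      have "exp (- \<alpha> * (dist y z / d)\<^sup>2) - exp (- \<alpha> * 13\<^sup>2) \<le> 1"
        using \<alpha> by (smt (verit) exp_ge_zero exp_le_one_iff mult_minus_left mult_nonneg_nonneg zero_le_power2)
      then have "m * (exp (- \<alpha> * (dist y z / d)\<^sup>2) - exp (- \<alpha> * 13\<^sup>2)) \<le> m"
        using m(1) mult_left_le by blast
      then show ?thesis using hole[OF that] by linarith
    qed
    show "m * (exp (- \<alpha> * (dist y z / d)\<^sup>2) - exp (- \<alpha> * 13\<^sup>2)) \<le> a * (\<nu> \<bullet> y) + 0"
      if "y \<in> frontier \<Omega>" "d * \<rho> \<le> dist y z" "dist y z \<le> d * 13" for y
    proof -
      have "norm y < 1" using small[OF that(3)] d by simp
      with that(1) have h: "0 \<le> \<nu> \<bullet> y"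
        by (intro closure_height_nonneg) (auto simp: frontier_def)
      \<comment> \<open>In units of \<open>d\<close> a point at height t is at distance at least |t
        - 13| from the centre, and 13^2 - (t - 13)^2 \<le> 26 t. The Gaussian term thus grows at
        most with slope \<open>26 * \<alpha>\<close>, which \<open>m(2)\<close> converts into the
        slope \<open>a\<close>.\<close>
      define t where "t = (\<nu> \<bullet> y) / d"
      have "\<bar>\<nu> \<bullet> (y - z)\<bar> \<le> dist y z"
        using Cauchy_Schwarz_ineq2[of \<nu> "y - z"] by (simp add: norm_\<nu> dist_norm)
      then have "\<bar>\<nu> \<bullet> (y - z)\<bar> / d \<le> dist y z / d"
        using d by (intro divide_right_mono) auto
      moreover have "\<nu> \<bullet> (y - z) = (t - 13) * d"
        using d by (simp add: t_def inner_diff_right z algebra_simps)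
      ultimately have "\<bar>t - 13\<bar> \<le> dist y z / d"
        using d by (simp add: abs_mult)
      then have "(t - 13)\<^sup>2 \<le> (dist y z / d)\<^sup>2"
        by (rule power2_le_iff_abs_le[THEN iffD2, rotated]) (use d in auto)
      then have "13\<^sup>2 - (dist y z / d)\<^sup>2 \<le> 26 * t"
        unfolding power2_diff using zero_le_power2[of t] by linarith
      then have "exp (- \<alpha> * (dist y z / d)\<^sup>2) - exp (- \<alpha> * 13\<^sup>2) \<le> \<alpha> * (26 * t)"
        using \<alpha> h d by (intro exp_diff_upper) (auto simp: t_def)
      then have "m * (exp (- \<alpha> * (dist y z / d)\<^sup>2) - exp (- \<alpha> * 13\<^sup>2)) \<le> m * (\<alpha> * (26 * t))"
        using m(1) by (rule mult_left_mono)
      also have "\<dots> = (m * (26 * \<alpha>)) * t" by simp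
      also have "\<dots> \<le> (a * d) * t"
        using m(2) h d by (intro mult_right_mono) (auto simp: t_def)
      also have "\<dots> = a * (\<nu> \<bullet> y) + 0" using d by (simp add: t_def)
      finally show ?thesis .
    qed
  qed
  then show ?thesis by simp
qed

text \<open>At a boundary point with tangential part longer than \<open>2 * d\<close> the height is at least
  \<open>2 * d * \<omega> (2 * d)\<close>, which yields a gain in a ball around \<open>z0\<close> that meets \<open>\<nu> \<bullet> x \<ge> 0\<close> only at such
  tangential distances. The tangent ball around \<open>z1\<close> carries the gain to a neighbourhood of
  \<open>13 * d\<close> times \<open>\<nu>\<close>, and the one around \<open>z2\<close>, tangent at the foot of \<open>x\<close>, carries it back down to \<open>x\<close>.\<close>

lemma improvement:
  assumes e: "norm e = 1" "\<nu> \<bullet> e = 0"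
    and d: "0 < d" "40 * d \<le> 1" and a: "0 \<le> a" and \<omega>1: "\<omega> (2 * d) \<le> 1"
    and le: "\<And>x. x \<in> \<Omega> \<Longrightarrow> norm x < 40 * d \<Longrightarrow> u x \<le> a * (\<nu> \<bullet> x)"
    and x: "x \<in> \<Omega>" "norm x < d / 4"
  shows "u x \<le> a * (1 - decay_const \<alpha> * \<omega> (2 * d)) * (\<nu> \<bullet> x)"
proof -
  define t where "t = \<omega> (2 * d)"
  have t: "0 \<le> t" "t \<le> 1" using nonneg[of "2 * d"] d \<omega>1 by (auto simp: t_def)
  have ee: "e \<bullet> e = 1" and e\<nu>: "e \<bullet> \<nu> = 0" using e by (auto simp: norm_eq_1 inner_commute)
  have dat: "0 \<le> d * a * t" "0 \<le> 2 * d * a * t" using d a t by simp_all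

  \<comment> \<open>The centre has height -d, so its inner ball of radius d misses \<Omega>. Within
    distance 35/2 d of it the component along \<open>e\<close> is at least (20 - 35/2) d, which
    exceeds the 2 d needed for the height bound.\<close>
  define z0 where "z0 = d *\<^sub>R (20 *\<^sub>R e - \<nu>)"
  define z1 where "z1 = d *\<^sub>R (12 *\<^sub>R e + 13 *\<^sub>R \<nu>)"
  define z2 where "z2 = (x - (\<nu> \<bullet> x) *\<^sub>R \<nu>) + (13 * d) *\<^sub>R \<nu>"

  have "norm z0 \<le> 21 * d"
    using d norm_triangle_ineq4[of "20 *\<^sub>R e" \<nu>] by (simp add: z0_def e norm_\<nu>)
  then have small: "norm y < 40 * d" if "dist y z0 \<le> d * (35/2)" for y
    using that d norm_triangle_sub[of y z0] by (simp add: dist_norm)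
  have stepA: "u y \<le> a * (\<nu> \<bullet> y) - d * a * t * bump_const \<alpha>"
    if y: "y \<in> \<Omega>" "dist y z0 \<le> d * 17" for y
  proof -
    have y': "dist y z0 \<le> d * (35/2)" using y d by simp
    have "u y \<le> a * (\<nu> \<bullet> y) + 0 -
        (2 * d * a * t) * (exp (- \<alpha> * (dist y z0 / d)\<^sup>2) - exp (- \<alpha> * (35/2)\<^sup>2))"
    proof (rule scaled_comparison[OF d(1), of 1, OF _ _ _ _ _ _ y(1) y'])
      show "norm z0 + d * (35/2) < 1" using \<open>norm z0 \<le> 21 * d\<close> d by simp
      show "u w \<le> a * (\<nu> \<bullet> w) + 0" if "w \<in> \<Omega>" "dist w z0 \<le> d * (35/2)" for w
        using le[OF that(1) small[OF that(2)]] by simp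
      show "u w \<le> a * (\<nu> \<bullet> w) + 0 -
          (2 * d * a * t) * (exp (- \<alpha> * (dist w z0 / d)\<^sup>2) - exp (- \<alpha> * (35/2)\<^sup>2))"
        if w: "w \<in> \<Omega>" "dist w z0 \<le> d * 1" for w
      proof -
        have "norm w < 1" using small[of w] w d by simp
        then have "0 < \<nu> \<bullet> w" using height_pos w by blast
        moreover have "\<nu> \<bullet> (w - z0) \<le> d"
          using norm_cauchy_schwarz[of \<nu> "w - z0"] w by (simp add: norm_\<nu> dist_norm)
        ultimately have False
          using d by (simp add: z0_def inner_diff_right e \<nu>_inner_\<nu>)
        then show ?thesis ..
      qed
      show "(2 * d * a * t) * (exp (- \<alpha> * (dist w z0 / d)\<^sup>2) - exp (- \<alpha> * (35/2)\<^sup>2))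
          \<le> a * (\<nu> \<bullet> w) + 0"
        if w: "w \<in> frontier \<Omega>" "d * 1 \<le> dist w z0" "dist w z0 \<le> d * (35/2)" for w
      proof -
        have "e \<bullet> (z0 - w) \<le> d * (35/2)"
          using norm_cauchy_schwarz[of e "z0 - w"] w by (simp add: e dist_norm norm_minus_commute)
        then have "2 * d < e \<bullet> w"
          using d by (simp add: z0_def inner_diff_right e\<nu> ee)
        also have "e \<bullet> w = e \<bullet> (w - (\<nu> \<bullet> w) *\<^sub>R \<nu>)"
          by (simp add: inner_diff_right e\<nu>)
        also have "\<dots> \<le> norm (w - (\<nu> \<bullet> w) *\<^sub>R \<nu>)"
          using norm_cauchy_schwarz[of e "w - (\<nu> \<bullet> w) *\<^sub>R \<nu>"] by (simp add: e)
        finally have "2 * d * \<omega> (2 * d) \<le> \<nu> \<bullet> w"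
          using w small[of w] d by (intro closure_height_ge) (auto simp: frontier_def)
        then have "a * (2 * d * t) \<le> a * (\<nu> \<bullet> w)"
          using a by (intro mult_left_mono) (auto simp: t_def)
        moreover have "exp (- \<alpha> * (dist w z0 / d)\<^sup>2) - exp (- \<alpha> * (35/2)\<^sup>2) \<le> 1"
          using \<alpha> by (smt (verit) exp_ge_zero exp_le_one_iff mult_minus_left mult_nonneg_nonneg zero_le_power2)
        then have "(2 * d * a * t) * (exp (- \<alpha> * (dist w z0 / d)\<^sup>2) - exp (- \<alpha> * (35/2)\<^sup>2))
            \<le> (2 * d * a * t) * 1"
          using dat(2) by (intro mult_left_mono)
        ultimately show ?thesis by (simp add: mult_ac)
      qed
    qed (use dat in auto)
    moreover have "d * a * t * bump_const \<alpha> \<le>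
        (2 * d * a * t) * (exp (- \<alpha> * (dist y z0 / d)\<^sup>2) - exp (- \<alpha> * (35/2)\<^sup>2))"
    proof -
      have "dist y z0 / d \<le> 17" using y d by (simp add: field_simps)
      then have "(dist y z0 / d)\<^sup>2 \<le> 17\<^sup>2" using d by (intro power_mono) auto
      then have "exp (- \<alpha> * 289) \<le> exp (- \<alpha> * (dist y z0 / d)\<^sup>2)"
        using \<alpha> by simp
      then have "bump_const \<alpha> \<le> exp (- \<alpha> * (dist y z0 / d)\<^sup>2) - exp (- \<alpha> * (35/2)\<^sup>2)"
        unfolding bump_const_def by linarith
      then show ?thesis
        using d a t bump_const_pos[of \<alpha>] \<alpha> by (intro mult_mono) auto
    qed
    ultimately show ?thesis by linarith
  qed

  \<comment> \<open>The caps in the constants, together with \<open>t \<le> 1\<close>, supply the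
    slope condition for both tangent balls.\<close>
  have bump_le: "d * a * t * bump_const \<alpha> * (26 * \<alpha>) \<le> a * d"
    "d * a * t * tangent_const \<alpha> * (26 * \<alpha>) \<le> a * d"
  proof -
    have *: "d * a * t * c * (26 * \<alpha>) \<le> a * d" if "c \<le> 1 / (26 * \<alpha>)" for c
    proof -
      have "c * (26 * \<alpha>) \<le> 1" using that \<alpha> by (simp add: field_simps)
      then have "d * a * t * (c * (26 * \<alpha>)) \<le> d * a * t * 1"
        using dat(1) by (rule mult_left_mono)
      also have "\<dots> \<le> d * a * 1" using t d a by (auto intro: mult_left_le)
      finally show ?thesis by (simp add: mult_ac)
    qed
    show "d * a * t * bump_const \<alpha> * (26 * \<alpha>) \<le> a * d"
      by (rule *) (simp add: bump_const_def)
    show "d * a * t * tangent_const \<alpha> * (26 * \<alpha>) \<le> a * d"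
      by (rule *) (simp add: tangent_const_def)
  qed

  \<comment> \<open>260 = 14^2 + 8^2 is below (33/2)^2, so the ball of radius 1/2 d around
    \<open>z1\<close> lies where \<open>stepA\<close> holds: 33/2 + 1/2 = 17.\<close>
  have dist01: "dist z1 z0 \<le> d * (33/2)"
  proof -
    have "z1 - z0 = d *\<^sub>R (14 *\<^sub>R \<nu> - 8 *\<^sub>R e)"
      by (simp add: z0_def z1_def vec_eq_iff algebra_simps)
    then have "dist z1 z0 = d * norm (14 *\<^sub>R \<nu> - 8 *\<^sub>R e)"
      using d by (simp add: dist_norm)
    moreover have "(norm (14 *\<^sub>R \<nu> - 8 *\<^sub>R e))\<^sup>2 = 260"
      unfolding power2_norm_eq_inner
      by (simp add: inner_diff_left inner_diff_right ee e e\<nu> \<nu>_inner_\<nu>)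
    then have "norm (14 *\<^sub>R \<nu> - 8 *\<^sub>R e) \<le> 33/2"
      using power2_le_imp_le[of "norm (14 *\<^sub>R \<nu> - 8 *\<^sub>R e)" "33/2"]
      by (simp add: power2_eq_square[of "33/2"])
    ultimately show ?thesis using d by simp
  qed
  have stepB: "u y \<le> a * (\<nu> \<bullet> y) - d * a * t * tangent_const \<alpha>"
    if y: "y \<in> \<Omega>" "dist y z1 \<le> d * (25/2)" for y
  proof -
    have "u y \<le> a * (\<nu> \<bullet> y) -
        (d * a * t * bump_const \<alpha>) * (exp (- \<alpha> * (dist y z1 / d)\<^sup>2) - exp (- \<alpha> * 169))"
    proof (rule tangent_ball_comparison[OF d a _ _ bump_le(1) le, of "1/2"])
      show "u w \<le> a * (\<nu> \<bullet> w) - d * a * t * bump_const \<alpha>"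
        if "w \<in> \<Omega>" "dist w z1 \<le> d * (1/2)" for w
        using stepA[OF that(1)] that(2) dist01 dist_triangle[of w z0 z1] by simp
      show "norm z1 \<le> 25 * d"
        using d norm_triangle_ineq[of "12 *\<^sub>R e" "13 *\<^sub>R \<nu>"] by (simp add: z1_def e norm_\<nu>)
      show "\<nu> \<bullet> z1 = 13 * d" by (simp add: z1_def inner_simps e \<nu>_inner_\<nu>)
    qed (use a t d bump_const_pos[of \<alpha>] \<alpha> y in auto)
    moreover have "d * a * t * tangent_const \<alpha> \<le>
        (d * a * t * bump_const \<alpha>) * (exp (- \<alpha> * (dist y z1 / d)\<^sup>2) - exp (- \<alpha> * 169))"
    proof -
      have "dist y z1 / d \<le> 25/2" using y d by (simp add: field_simps)
      then have "(dist y z1 / d)\<^sup>2 \<le> (25/2)\<^sup>2" using d by (intro power_mono) auto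
      then have "exp (- \<alpha> * (25/2)\<^sup>2) \<le> exp (- \<alpha> * (dist y z1 / d)\<^sup>2)"
        using \<alpha> by simp
      then have "bump_const \<alpha> * (exp (- \<alpha> * (25/2)\<^sup>2) - exp (- \<alpha> * 169)) \<le>
          bump_const \<alpha> * (exp (- \<alpha> * (dist y z1 / d)\<^sup>2) - exp (- \<alpha> * 169))"
        using bump_const_pos[of \<alpha>] \<alpha> by (intro mult_left_mono) auto
      then have "tangent_const \<alpha> \<le>
          bump_const \<alpha> * (exp (- \<alpha> * (dist y z1 / d)\<^sup>2) - exp (- \<alpha> * 169))"
        unfolding tangent_const_def by linarith
      then show ?thesis
        using mult_left_mono[OF _ dat(1)] by (simp add: mult.assoc)
    qed
    ultimately show ?thesis by linarith
  qed

  define h where "h = (\<nu> \<bullet> x) / d"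
  have tang: "norm (x - (\<nu> \<bullet> x) *\<^sub>R \<nu>) \<le> d / 4"
    using norm_tangential_le[of x] x by simp
  have "norm x < 1" using x d by simp
  then have hpos: "0 < h" using height_pos x d by (simp add: h_def)
  have "\<nu> \<bullet> x \<le> norm x" using norm_cauchy_schwarz[of \<nu> x] by (simp add: norm_\<nu>)
  then have h1: "h \<le> 1" using x d by (simp add: h_def field_simps)
  have dist2: "dist x z2 / d = 13 - h"
  proof -
    have "x - z2 = (\<nu> \<bullet> x - 13 * d) *\<^sub>R \<nu>" by (simp add: z2_def algebra_simps)
    then have "dist x z2 = \<bar>\<nu> \<bullet> x - 13 * d\<bar>" by (simp add: dist_norm norm_\<nu>)
    also have "\<nu> \<bullet> x = h * d" using d by (simp add: h_def)
    also have "h * d - 13 * d = - ((13 - h) * d)" by (simp add: algebra_simps)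
    finally show ?thesis using h1 d by (simp add: abs_mult)
  qed
  \<comment> \<open>The restriction \<open>norm x < d / 4\<close> enters here: 12 + 1/4, plus the
    inner radius 1/4, is the 25/2 of \<open>stepB\<close>.\<close>
  have dist12: "dist z2 z1 \<le> d * (49/4)"
  proof -
    have "z2 - z1 = (x - (\<nu> \<bullet> x) *\<^sub>R \<nu>) - (12 * d) *\<^sub>R e"
      by (simp add: z1_def z2_def algebra_simps)
    then have "dist z2 z1 \<le> norm (x - (\<nu> \<bullet> x) *\<^sub>R \<nu>) + norm ((12 * d) *\<^sub>R e)"
      by (simp only: dist_norm norm_triangle_ineq4)
    then show ?thesis using tang d by (simp add: e)
  qed
  have "u x \<le> a * (\<nu> \<bullet> x) -
      (d * a * t * tangent_const \<alpha>) * (exp (- \<alpha> * (dist x z2 / d)\<^sup>2) - exp (- \<alpha> * 169))"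
  proof (rule tangent_ball_comparison[OF d a _ _ bump_le(2) le, of "1/4"])
    show "u w \<le> a * (\<nu> \<bullet> w) - d * a * t * tangent_const \<alpha>"
      if "w \<in> \<Omega>" "dist w z2 \<le> d * (1/4)" for w
      using stepB[OF that(1)] that(2) dist12 dist_triangle[of w z1 z2] by simp
    show "norm z2 \<le> 25 * d"
      using d tang norm_triangle_ineq[of "x - (\<nu> \<bullet> x) *\<^sub>R \<nu>" "(13 * d) *\<^sub>R \<nu>"]
      by (simp add: z2_def norm_\<nu>)
    show "\<nu> \<bullet> z2 = 13 * d" by (simp add: z2_def inner_simps \<nu>_inner_\<nu>)
    have "dist x z2 / d \<le> 13" using dist2 hpos by simp
    then show "dist x z2 \<le> d * 13" using d by (simp add: field_simps)
  qed (use a t d tangent_const_pos[of \<alpha>] \<alpha> x in auto)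
  moreover have "a * (decay_const \<alpha> * t) * (\<nu> \<bullet> x) \<le>
      (d * a * t * tangent_const \<alpha>) * (exp (- \<alpha> * (dist x z2 / d)\<^sup>2) - exp (- \<alpha> * 169))"
  proof -
    have "13 * h \<le> 169 - (13 - h)\<^sup>2"
      using hpos h1 mult_left_le_one_le[of h h] by (simp add: power2_eq_square algebra_simps)
    then have "exp (- \<alpha> * 169) * (\<alpha> * (13 * h)) \<le> exp (- \<alpha> * 169) * (\<alpha> * (169 - (13 - h)\<^sup>2))"
      using \<alpha> by simp
    also have "\<dots> \<le> exp (- \<alpha> * (13 - h)\<^sup>2) - exp (- \<alpha> * 169)"
      by (rule exp_diff_lower)
    finally have "(d * a * t * tangent_const \<alpha>) * (exp (- \<alpha> * 169) * (\<alpha> * (13 * h))) \<le>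
        (d * a * t * tangent_const \<alpha>) * (exp (- \<alpha> * (13 - h)\<^sup>2) - exp (- \<alpha> * 169))"
      using a t d tangent_const_pos[of \<alpha>] \<alpha> by (intro mult_left_mono) auto
    moreover have "(d * a * t * tangent_const \<alpha>) * (exp (- \<alpha> * 169) * (\<alpha> * (13 * h))) =
        a * (decay_const \<alpha> * t) * (h * d)"
      by (simp add: decay_const_def mult_ac)
    moreover have "h * d = \<nu> \<bullet> x" using d by (simp add: h_def)
    ultimately show ?thesis by (simp only: dist2)
  qed
  ultimately show ?thesis by (simp add: t_def algebra_simps)
qed

text \<open>The majorant is the constant \<open>M\<close>, and \<open>K = M / E\<close> makes the
  barrier vanish on the inner sphere, which touches the hyperplane at the foot of \<open>x\<close>
  from below. The inner ball therefore misses \<Omega>, and on the frontier the barrier is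
  nonnegative.\<close>

lemma linear_bound:
  assumes M: "0 \<le> M" "\<And>x. x \<in> \<Omega> \<Longrightarrow> norm x < 1 \<Longrightarrow> u x \<le> M"
    and x: "x \<in> \<Omega>" "norm x < 1/5"
  shows "u x \<le> linear_const \<alpha> * M * (\<nu> \<bullet> x)"
proof -
  define d :: real where "d = 1/5"
  define z where "z = (x - (\<nu> \<bullet> x) *\<^sub>R \<nu>) - d *\<^sub>R \<nu>"
  define E where "E = exp (- \<alpha>) - exp (- \<alpha> * 4)"
  have E: "0 < E" using \<alpha> by (simp add: E_def)
  have nz: "norm z < 2/5"
    using x norm_tangential_le[of x]
      norm_triangle_ineq4[of "x - (\<nu> \<bullet> x) *\<^sub>R \<nu>" "d *\<^sub>R \<nu>"]
    by (simp add: z_def norm_\<nu> d_def)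
  define h where "h = (\<nu> \<bullet> x) / d"
  have hpos: "0 < h" using height_pos[OF x(1)] x by (simp add: h_def d_def)
  have "\<nu> \<bullet> x \<le> norm x" using norm_cauchy_schwarz[of \<nu> x] by (simp add: norm_\<nu>)
  then have h1: "h \<le> 1" using x by (simp add: h_def d_def)
  have "x - z = (\<nu> \<bullet> x + d) *\<^sub>R \<nu>" by (simp add: z_def algebra_simps)
  then have "dist x z = \<bar>\<nu> \<bullet> x + d\<bar>" by (simp add: dist_norm norm_\<nu>)
  then have dist: "dist x z / d = 1 + h"
    using hpos by (simp add: h_def d_def)
  have "u x \<le> 0 * (\<nu> \<bullet> x) + M - (M / E) * (exp (- \<alpha> * (dist x z / d)\<^sup>2) - exp (- \<alpha> * 2\<^sup>2))"
  proof (rule scaled_comparison[of _ 1])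
    show "norm z + d * 2 < 1" using nz by (simp add: d_def)
    show "u y \<le> 0 * (\<nu> \<bullet> y) + M" if "y \<in> \<Omega>" "dist y z \<le> d * 2" for y
      using M(2)[OF that(1)] that(2) nz norm_triangle_sub[of y z] by (simp add: dist_norm d_def)
    show "u y \<le> 0 * (\<nu> \<bullet> y) + M - (M / E) * (exp (- \<alpha> * (dist y z / d)\<^sup>2) - exp (- \<alpha> * 2\<^sup>2))"
      if y: "y \<in> \<Omega>" "dist y z \<le> d * 1" for y
    proof -
      have "norm y < 1"
        using y(2) nz norm_triangle_sub[of y z] by (simp add: dist_norm d_def)
      then have "0 < \<nu> \<bullet> y" using height_pos y by blast
      moreover have "\<nu> \<bullet> (y - z) \<le> d"
        using norm_cauchy_schwarz[of \<nu> "y - z"] y by (simp add: norm_\<nu> dist_norm)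
      ultimately have False
        by (simp add: z_def inner_diff_right \<nu>_inner_\<nu> d_def)
      then show ?thesis ..
    qed
    show "(M / E) * (exp (- \<alpha> * (dist y z / d)\<^sup>2) - exp (- \<alpha> * 2\<^sup>2)) \<le> 0 * (\<nu> \<bullet> y) + M"
      if y: "y \<in> frontier \<Omega>" "d * 1 \<le> dist y z" "dist y z \<le> d * 2" for y
    proof -
      have "1 \<le> dist y z / d" using y by (simp add: d_def)
      then have "1 \<le> (dist y z / d)\<^sup>2" by (rule one_le_power)
      then have "exp (- \<alpha> * (dist y z / d)\<^sup>2) \<le> exp (- \<alpha>)"
        using \<alpha> by simp
      then have "(M / E) * (exp (- \<alpha> * (dist y z / d)\<^sup>2) - exp (- \<alpha> * 2\<^sup>2)) \<le> (M / E) * E"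
        using M E by (intro mult_left_mono) (auto simp: E_def)
      then show ?thesis using E by simp
    qed
  qed (use x M E dist h1 in \<open>auto simp: d_def\<close>)
  also have "\<dots> = (M / E) * (exp (- \<alpha> * 1) - exp (- \<alpha> * (1 + h)\<^sup>2))"
    using E by (simp add: dist) (simp add: E_def field_simps)
  also have "\<dots> \<le> (M / E) * (\<alpha> * (3 * h))"
    using M E \<alpha> hpos h1 mult_left_le_one_le[of h h]
    by (intro mult_left_mono exp_diff_upper) (auto simp: power2_eq_square algebra_simps)
  also have "\<dots> = linear_const \<alpha> * M * (\<nu> \<bullet> x)"
    by (simp add: linear_const_def E_def h_def d_def)
  finally show ?thesis .
qed

end

section \<open>Iteration over the scales\<close>

text \<open>The start 1/5 is the radius of \<open>linear_bound\<close>. The ratio 160 = 40 * 4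
  arises because \<open>improvement\<close> uses the ball of radius \<open>40 * d\<close> and
  concludes on that of radius \<open>d / 4\<close>.\<close>

definition decay_scale :: "nat \<Rightarrow> real" where
  "decay_scale k = (1 / 160) ^ k / 5"

text \<open>With \<open>40 * d\<close> equal to the scale, the argument of \<omega> is the
  \<open>2 * d\<close> of \<open>improvement\<close>.\<close>

definition decay_prod :: "real \<Rightarrow> (real \<Rightarrow> real) \<Rightarrow> nat \<Rightarrow> real" where
  "decay_prod c \<omega> k = (\<Prod>j<k. 1 - c * \<omega> (decay_scale j / 20))"

text \<open>The summand \<open>r\<close> makes the modulus positive, which matters when the supremum of \<open>u\<close> is
  infinite, as \<open>\<infinity> * 0 = 0\<close> in \<^typ>\<open>ereal\<close>.\<close>

definition decay_modulus :: "real \<Rightarrow> real \<Rightarrow> (real \<Rightarrow> real) \<Rightarrow> real \<Rightarrow> real" where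
  "decay_modulus C c \<omega> r = r + (INF k\<in>{k. r < decay_scale k}. C * decay_prod c \<omega> k)"

lemma decay_scale_pos: "0 < decay_scale k"
  by (simp add: decay_scale_def)

lemma decay_scale_0: "decay_scale 0 = 1 / 5"
  by (simp add: decay_scale_def)

lemma decay_scale_Suc: "decay_scale (Suc k) = decay_scale k / 160"
  by (simp add: decay_scale_def)

lemma decay_scale_le: "decay_scale k \<le> 1 / 5"
  by (induction k) (auto simp: decay_scale_0 decay_scale_Suc)

lemma decay_scale_tendsto_0: "decay_scale \<longlonglongrightarrow> 0"
  unfolding decay_scale_def by (intro tendsto_divide_zero LIMSEQ_power_zero) auto

text \<open>Between s/160 and s monotonicity gives
  \<open>\<omega> r / r \<le> 160 * \<omega> s / s\<close>, and the integral of the right side over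
  an interval of length s is \<open>160 * \<omega> s\<close>. A convergent sum would make the Dini
  integral finite.\<close>

lemma not_summable_scales:
  fixes \<omega> :: "real \<Rightarrow> real"
  assumes mono: "mono_on {0..} \<omega>" and nonneg: "\<And>r. 0 \<le> r \<Longrightarrow> 0 \<le> \<omega> r"
    and div: "(\<integral>\<^sup>+ r\<in>{0<..<1}. ennreal (\<omega> r / r) \<partial>lborel) = \<infinity>"
  shows "\<not> summable (\<lambda>j. \<omega> (decay_scale j / 20))"
proof
  assume sum: "summable (\<lambda>j. \<omega> (decay_scale j / 20))"
  define s where "s j = decay_scale j / 20" for j
  have s: "0 < s j" "s (Suc j) = s j / 160" for j
    using decay_scale_pos[of j] by (auto simp: s_def decay_scale_Suc)
  have s0: "s 0 = 1 / 100" by (simp add: s_def decay_scale_0)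
  \<comment> \<open>Each bound is spread over all of \<open>{0..s j}\<close> instead of one shell:
    overlaps are harmless for an upper estimate. The function \<open>B\<close> takes care of r above
    \<open>s 0\<close>.\<close>
  define T where "T j r = ennreal (160 * \<omega> (s j) / s j) * indicator {0..s j} r" for j and r :: real
  define B where "B r = ennreal (\<omega> 1 * 100) * indicator {0..1} r" for r :: real
  have pt: "ennreal (\<omega> r / r) * indicator {0<..<1} r \<le> B r + (\<Sum>j. T j r)" for r
  proof (cases "r \<in> {0<..<1}")
    case r: True
    show ?thesis
    proof (cases "r \<le> s 0")
      case False
      have "\<omega> r / r \<le> \<omega> 1 / (1 / 100)"
        using r False nonneg[of 1] by (intro frac_le mono_onD[OF mono]) (auto simp: s0)
      then have "ennreal (\<omega> r / r) * indicator {0<..<1} r \<le> B r"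
        using r by (simp add: B_def ennreal_leI)
      then show ?thesis by (rule order_trans) simp
    next
      case True
      have "s \<longlonglongrightarrow> 0" unfolding s_def by (intro tendsto_divide_zero decay_scale_tendsto_0)
      then have "\<forall>\<^sub>F j in sequentially. s j < r" using r by (auto elim: order_tendstoD)
      then obtain N where "s N < r" using eventually_happens'[OF sequentially_bot] by blast
      \<comment> \<open>The predecessor of the first scale below r is the scale whose shell contains
        r; it exists because \<open>r \<le> s 0\<close>.\<close>
      define i where "i = (LEAST i. s i < r)"
      have i: "s i < r" unfolding i_def by (rule LeastI[of _ N]) fact
      then obtain j where j: "i = Suc j" using True by (cases i) auto
      then have "\<not> s j < r" using not_less_Least[of j "\<lambda>i. s i < r"] by (simp add: i_def)
      then have le: "r \<le> s j" "s j / 160 < r" using i j s by auto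
      have "\<omega> r / r \<le> \<omega> (s j) / (s j / 160)"
        using r le s[of j] nonneg[of "s j"] by (intro frac_le mono_onD[OF mono]) auto
      then have "ennreal (\<omega> r / r) * indicator {0<..<1} r \<le> T j r"
        using r le by (simp add: T_def ennreal_leI mult.commute)
      also have "\<dots> \<le> (\<Sum>j. T j r)"
        using sum_le_suminf[of "\<lambda>j. T j r" "{j}"] by simp
      finally show ?thesis by (simp add: add_increasing)
    qed
  qed simp
  have TI: "(\<integral>\<^sup>+ r. T j r \<partial>lborel) = ennreal (160 * \<omega> (s j))" for j
  proof -
    have "(\<integral>\<^sup>+ r. T j r \<partial>lborel) = ennreal (160 * \<omega> (s j) / s j) * ennreal (s j)"
      unfolding T_def using s[of j] by (subst nn_integral_cmult_indicator) auto
    also have "\<dots> = ennreal (160 * \<omega> (s j))"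
      using s(1)[of j] nonneg[of "s j"] by (subst ennreal_mult[symmetric]) auto
    finally show ?thesis .
  qed
  have "(\<integral>\<^sup>+ r\<in>{0<..<1}. ennreal (\<omega> r / r) \<partial>lborel) \<le> (\<integral>\<^sup>+ r. B r + (\<Sum>j. T j r) \<partial>lborel)"
    by (intro nn_integral_mono pt)
  also have "\<dots> = (\<integral>\<^sup>+ r. B r \<partial>lborel) + (\<Sum>j. \<integral>\<^sup>+ r. T j r \<partial>lborel)"
    unfolding B_def T_def by (subst nn_integral_add, measurable) (subst nn_integral_suminf, measurable)
  also have "\<dots> = ennreal (\<omega> 1 * 100) + ennreal (\<Sum>j. 160 * \<omega> (s j))"
  proof -
    have "(\<integral>\<^sup>+ r. B r \<partial>lborel) = ennreal (\<omega> 1 * 100)"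
      unfolding B_def by (subst nn_integral_cmult_indicator) auto
    moreover have "(\<Sum>j. ennreal (160 * \<omega> (s j))) = ennreal (\<Sum>j. 160 * \<omega> (s j))"
      using sum s(1) nonneg
      by (intro suminf_ennreal2 summable_mult) (auto simp: s_def less_imp_le)
    ultimately show ?thesis by (simp add: TI)
  qed
  also have "\<dots> < \<infinity>" by simp
  finally show False using div by simp
qed

lemma decay_prod_bounds:
  assumes "\<And>j. 0 \<le> c * \<omega> (decay_scale j / 20)" "\<And>j. c * \<omega> (decay_scale j / 20) \<le> 1"
  shows "0 \<le> decay_prod c \<omega> k" "decay_prod c \<omega> k \<le> exp (- (\<Sum>j<k. c * \<omega> (decay_scale j / 20)))"
proof -
  show "0 \<le> decay_prod c \<omega> k"
    unfolding decay_prod_def using assms by (intro prod_nonneg) auto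
  have "decay_prod c \<omega> k \<le> (\<Prod>j<k. exp (- (c * \<omega> (decay_scale j / 20))))"
    unfolding decay_prod_def
  proof (intro prod_mono conjI)
    show "1 - c * \<omega> (decay_scale j / 20) \<le> exp (- (c * \<omega> (decay_scale j / 20)))" for j
      using exp_ge_add_one_self[of "- (c * \<omega> (decay_scale j / 20))"] by simp
  qed (use assms in auto)
  then show "decay_prod c \<omega> k \<le> exp (- (\<Sum>j<k. c * \<omega> (decay_scale j / 20)))"
    by (simp add: exp_sum sum_negf[symmetric])
qed

text \<open>By 1 - x \<le> exp (- x) it suffices that some partial sum exceeds
  \<open>- ln \<epsilon>\<close>, and divergence provides one.\<close>

lemma decay_prod_small:
  assumes c: "0 < c" and bounds: "\<And>j. 0 \<le> \<omega> (decay_scale j / 20)" "\<And>j. c * \<omega> (decay_scale j / 20) \<le> 1"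
    and div: "\<not> summable (\<lambda>j. \<omega> (decay_scale j / 20))" and \<epsilon>: "0 < \<epsilon>"
  obtains k where "decay_prod c \<omega> k < \<epsilon>"
proof -
  have "\<not> summable (\<lambda>j. c * \<omega> (decay_scale j / 20))"
    using div c by (simp add: summable_cmult_iff)
  then obtain k where "(\<Sum>j<k. c * \<omega> (decay_scale j / 20)) > - ln \<epsilon>"
    using summableI_nonneg_bounded[of "\<lambda>j. c * \<omega> (decay_scale j / 20)" "- ln \<epsilon>"] c bounds(1)
    by (meson less_imp_le linorder_not_le mult_nonneg_nonneg)
  then have "exp (- (\<Sum>j<k. c * \<omega> (decay_scale j / 20))) < exp (ln \<epsilon>)"
    by (subst exp_less_cancel_iff) linarith
  moreover have "decay_prod c \<omega> k \<le> exp (- (\<Sum>j<k. c * \<omega> (decay_scale j / 20)))"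
    using bounds c by (intro decay_prod_bounds) auto
  ultimately show thesis using that[of k] \<epsilon> by simp
qed

context
  fixes C c :: real and \<omega> :: "real \<Rightarrow> real"
  assumes C: "0 < C" and c: "0 < c"
    and bounds: "\<And>j. 0 \<le> \<omega> (decay_scale j / 20)" "\<And>j. c * \<omega> (decay_scale j / 20) \<le> 1"
begin

lemma C_decay_prod_nonneg: "0 \<le> C * decay_prod c \<omega> k"
  using C c bounds decay_prod_bounds(1)[of c \<omega> k] by simp

lemma bdd_below_decay_prod: "bdd_below ((\<lambda>k. C * decay_prod c \<omega> k) ` A)"
  using C_decay_prod_nonneg by (intro bdd_belowI2)

lemma decay_modulus_ge:
  assumes "0 \<le> r" "r < 1 / 5" "\<And>k. r < decay_scale k \<Longrightarrow> v \<le> C * decay_prod c \<omega> k"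
  shows "v \<le> decay_modulus C c \<omega> r"
proof -
  have "v \<le> (INF k\<in>{k. r < decay_scale k}. C * decay_prod c \<omega> k)"
    using assms by (intro cINF_greatest) (auto simp: decay_scale_0 intro!: exI[of _ 0])
  then show ?thesis using assms(1) by (simp add: decay_modulus_def)
qed

lemma decay_modulus_pos:
  assumes "0 < r" "r < 1 / 5"
  shows "0 < decay_modulus C c \<omega> r"
proof -
  have "0 \<le> (INF k\<in>{k. r < decay_scale k}. C * decay_prod c \<omega> k)"
    using assms C_decay_prod_nonneg
    by (intro cINF_greatest) (auto simp: decay_scale_0 intro!: exI[of _ 0])
  then show ?thesis using assms by (simp add: decay_modulus_def)
qed

lemma decay_modulus_le: "r < decay_scale k \<Longrightarrow> decay_modulus C c \<omega> r \<le> r + C * decay_prod c \<omega> k"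
  unfolding decay_modulus_def using bdd_below_decay_prod by (intro add_left_mono cINF_lower) auto

text \<open>A larger radius lies below fewer scales, so the infimum runs over a smaller set; for
  radii below 1/5 the index 0 keeps that set nonempty.\<close>

lemma mono_on_decay_modulus: "mono_on {0<..<1 / 5} (decay_modulus C c \<omega>)"
proof (rule mono_onI)
  fix r s :: real assume "r \<in> {0<..<1 / 5}" "s \<in> {0<..<1 / 5}" "r \<le> s"
  then show "decay_modulus C c \<omega> r \<le> decay_modulus C c \<omega> s"
    unfolding decay_modulus_def using decay_scale_0 bdd_below_decay_prod
    by (intro add_mono cINF_superset_mono) (auto intro: exI[of _ 0])
qed

lemma decay_modulus_tendsto_0:
  assumes div: "\<not> summable (\<lambda>j. \<omega> (decay_scale j / 20))"
  shows "(decay_modulus C c \<omega> \<longlongrightarrow> 0) (at_right 0)"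
proof (rule order_tendstoI)
  fix a :: real assume "a < 0"
  have "\<forall>\<^sub>F r in at_right (0::real). r \<in> {0<..<1 / 5}"
    by (rule eventually_at_right_real) simp
  then show "\<forall>\<^sub>F r in at_right 0. a < decay_modulus C c \<omega> r"
    by eventually_elim (use \<open>a < 0\<close> decay_modulus_pos less_trans in auto)
next
  fix a :: real assume a: "0 < a"
  then have "0 < a / (2 * C)" using C by simp
  from decay_prod_small[OF c bounds div this] obtain k where "decay_prod c \<omega> k < a / (2 * C)" .
  then have k: "C * decay_prod c \<omega> k < a / 2" using C by (simp add: field_simps)
  have "\<forall>\<^sub>F r in at_right (0::real). r \<in> {0<..<min (decay_scale k) (a / 2)}"
    using a decay_scale_pos by (intro eventually_at_right_real) simp
  then show "\<forall>\<^sub>F r in at_right 0. decay_modulus C c \<omega> r < a"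
  proof eventually_elim
    case (elim r)
    then show ?case using decay_modulus_le[of r k] k by simp
  qed
qed

end

section \<open>Decay of the slope along the scales, and the final estimate\<close>

context pucci_subsolution_above_graph
begin

lemma decay:
  assumes e: "norm e = 1" "\<nu> \<bullet> e = 0" and \<omega>1: "\<omega> 1 < 1 / 4"
    and M: "0 \<le> M" "\<And>x. x \<in> \<Omega> \<Longrightarrow> norm x < 1 \<Longrightarrow> u x \<le> M"
    and x: "x \<in> \<Omega>" "norm x < decay_scale k"
  shows "u x \<le> linear_const \<alpha> * M * decay_prod (decay_const \<alpha>) \<omega> k * (\<nu> \<bullet> x)"
  using x
proof (induction k arbitrary: x)
  case 0
  then show ?case using linear_bound[OF M] by (simp add: decay_scale_0 decay_prod_def)
next
  case (Suc k)
  define d where "d = decay_scale k / 40"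
  have d: "0 < d" "40 * d \<le> 1" using decay_scale_pos[of k] decay_scale_le[of k] by (auto simp: d_def)
  have \<omega>_le: "\<omega> (decay_scale j / 20) \<le> 1 / 4" for j
    using mono_onD[OF mono, of "decay_scale j / 20" 1] decay_scale_pos[of j] decay_scale_le[of j] \<omega>1 by auto
  \<comment> \<open>Factors in [0, 1] keep the slope reached so far nonnegative, as
    \<open>improvement\<close> demands.\<close>
  have "decay_const \<alpha> * \<omega> (decay_scale j / 20) \<le> 1 * 1" for j
    using \<omega>_le[of j] decay_const_le[OF \<alpha>(1)] decay_const_pos[OF \<alpha>(1)] nonneg[of "decay_scale j / 20"]
      decay_scale_pos[of j] by (intro mult_mono) auto
  moreover have "0 \<le> decay_const \<alpha> * \<omega> (decay_scale j / 20)" for j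
    using decay_const_pos[OF \<alpha>(1)] nonneg[of "decay_scale j / 20"] decay_scale_pos[of j] by simp
  ultimately have "0 \<le> decay_prod (decay_const \<alpha>) \<omega> k"
    by (intro decay_prod_bounds) auto
  then have a: "0 \<le> linear_const \<alpha> * M * decay_prod (decay_const \<alpha>) \<omega> k"
    using M(1) linear_const_pos[OF \<alpha>(1)] by simp
  have "u x \<le> linear_const \<alpha> * M * decay_prod (decay_const \<alpha>) \<omega> k *
      (1 - decay_const \<alpha> * \<omega> (2 * d)) * (\<nu> \<bullet> x)"
  proof (rule improvement[OF e d a])
    show "\<omega> (2 * d) \<le> 1" using \<omega>_le[of k] by (simp add: d_def)
    show "norm x < d / 4" using Suc.prems by (simp add: d_def decay_scale_Suc)
    show "u y \<le> linear_const \<alpha> * M * decay_prod (decay_const \<alpha>) \<omega> k * (\<nu> \<bullet> y)"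
      if "y \<in> \<Omega>" "norm y < 40 * d" for y
      using Suc.IH[of y] that by (simp add: d_def)
  qed (rule Suc.prems)
  then show ?case by (simp add: decay_prod_def d_def mult_ac)
qed

end

theorem theorem1p18:
  fixes lam Lam :: real and \<omega> :: "real \<Rightarrow> real"
  assumes "CARD('n::finite) \<ge> 2"
    and "0 < lam" and "lam \<le> Lam"
    and "\<omega> 1 < 1 / 4"
  shows "\<exists>\<delta>>0. \<exists>\<omega>' :: real \<Rightarrow> real.
    (\<forall>r\<in>{0<..<\<delta>}. 0 \<le> \<omega>' r) \<and> mono_on {0<..<\<delta>} \<omega>' \<and> (\<omega>' \<longlongrightarrow> 0) (at_right 0) \<and>
    (\<forall>(\<Omega> :: (real ^ 'n) set) (u :: real ^ 'n \<Rightarrow> real).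
       open \<Omega> \<and> connected \<Omega> \<and> anti_interior_C1Dini \<Omega> 1 \<omega> \<and>
       continuous_on (closure \<Omega> \<inter> ball 0 1) u \<and>
       pucci_subsolution lam Lam (\<Omega> \<inter> ball 0 1) u \<and>
       (\<forall>x\<in>frontier \<Omega> \<inter> ball 0 1. u x \<le> 0)
       \<longrightarrow> (\<forall>x\<in>\<Omega> \<inter> ball 0 \<delta>.
              ereal (u x) \<le> (SUP y\<in>\<Omega> \<inter> ball 0 1. ereal (max (u y) 0))
                             * ereal (norm x * \<omega>' (norm x))))"
proof (cases "mono_on {0..} \<omega> \<and> (\<forall>r\<ge>0. 0 \<le> \<omega> r) \<and>
    (\<integral>\<^sup>+ r\<in>{0<..<1}. ennreal (\<omega> r / r) \<partial>lborel) = \<infinity>")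
  case False
  \<comment> \<open>The modulus is chosen before \<Omega>. If \<omega> itself is inadmissible, no
    domain satisfies the condition and any modulus will do.\<close>
  then have "\<not> anti_interior_C1Dini \<Omega> 1 \<omega>" for \<Omega> :: "(real ^ 'n) set"
    unfolding anti_interior_C1Dini_def by blast
  then show ?thesis
    by (intro exI[of _ 1] exI[of _ "\<lambda>r. r"] conjI) (auto intro!: mono_onI tendsto_eq_intros)
next
  case True
  then have mono: "mono_on {0..} \<omega>" and nonneg: "\<And>r. 0 \<le> r \<Longrightarrow> 0 \<le> \<omega> r"
    and div: "\<not> summable (\<lambda>j. \<omega> (decay_scale j / 20))"
    using not_summable_scales by blast+
  \<comment> \<open>Solves the negativity condition with a surplus of 1, from n, \<open>lam\<close>
    and \<open>Lam\<close> alone.\<close>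
  define \<alpha> where "\<alpha> = 8 * (Lam * (real CARD('n) - 1) + lam + 1) / lam"
  have "0 \<le> Lam * (real CARD('n) - 1)" using assms by simp
  then have \<alpha>: "0 < \<alpha>" "Lam * (real CARD('n) - 1) + lam < \<alpha> * lam / 8"
    using assms(2) by (auto simp: \<alpha>_def intro!: divide_pos_pos)
  note C = linear_const_pos[OF \<alpha>(1)] and c = decay_const_pos[OF \<alpha>(1)]
  have \<omega>_nonneg: "0 \<le> \<omega> (decay_scale j / 20)" for j
    using nonneg decay_scale_pos[of j] by simp
  have c\<omega>_le: "decay_const \<alpha> * \<omega> (decay_scale j / 20) \<le> 1" for j
  proof -
    have "\<omega> (decay_scale j / 20) \<le> 1"
      using mono_onD[OF mono, of "decay_scale j / 20" 1] decay_scale_pos[of j] decay_scale_le[of j] assms(4) by auto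
    then show ?thesis
      using decay_const_le[OF \<alpha>(1)] c \<omega>_nonneg[of j] mult_le_one by fastforce
  qed
  note modulus_facts = C c \<omega>_nonneg c\<omega>_le
  define \<omega>' where "\<omega>' = decay_modulus (linear_const \<alpha>) (decay_const \<alpha>) \<omega>"
  have "ereal (u x) \<le> (SUP y\<in>\<Omega> \<inter> ball 0 1. ereal (max (u y) 0)) * ereal (norm x * \<omega>' (norm x))"
    if \<Omega>: "open \<Omega>" and dini: "anti_interior_C1Dini \<Omega> 1 \<omega>"
      and u: "continuous_on (closure \<Omega> \<inter> ball 0 1) u" "pucci_subsolution lam Lam (\<Omega> \<inter> ball 0 1) u"
        "\<forall>x\<in>frontier \<Omega> \<inter> ball 0 1. u x \<le> 0"
      and x: "x \<in> \<Omega> \<inter> ball 0 (1 / 5)"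
    for \<Omega> :: "(real ^ 'n) set" and u x
  proof -
    obtain T :: "real ^ 'n \<Rightarrow> real ^ 'n" and m where T: "orthogonal_transformation T"
      and below: "ball 0 1 \<inter> {x. T x $ m \<le> norm (tangential m (T x)) * \<omega> (norm (tangential m (T x)))}
          \<subseteq> ball 0 1 \<inter> - \<Omega>"
      using dini unfolding anti_interior_C1Dini_def by blast
    have surjT: "surj T" by (rule orthogonal_transformation_surj[OF T])
    obtain \<nu> where \<nu>: "T \<nu> = axis m 1" using surjT by (metis surjD)
    \<comment> \<open>Dimension at least 2 provides a tangential direction, along which the gain is
      sought.\<close>
    have "\<exists>j. j \<noteq> m"
    proof (rule ccontr)
      assume "\<nexists>j. j \<noteq> m"
      then have "(UNIV :: 'n set) = {m}" by auto
      then have "card (UNIV :: 'n set) = card {m}" by (rule arg_cong)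
      then show False using assms(1) by simp
    qed
    then obtain j where j: "j \<noteq> m" by blast
    obtain e where e: "T e = axis j 1" using surjT by (metis surjD)
    have inner_T: "v \<bullet> w = T v \<bullet> T w" for v w
      using T by (simp add: orthogonal_transformation_def)
    have norm_T: "norm (T v) = norm v" for v
      by (rule orthogonal_transformation_norm[OF T])
    have coord: "T v $ m = \<nu> \<bullet> v" for v
      unfolding inner_T[of \<nu>] \<nu> by (simp add: inner_axis')
    have tang: "norm (tangential m (T v)) = norm (v - (\<nu> \<bullet> v) *\<^sub>R \<nu>)" for v
    proof -
      have "T (v - (\<nu> \<bullet> v) *\<^sub>R \<nu>) = T v - (\<nu> \<bullet> v) *\<^sub>R T \<nu>"
        using orthogonal_transformation_linear[OF T] by (simp add: linear_diff linear_scale)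
      also have "\<dots> = tangential m (T v)"
        by (simp add: \<nu> coord[symmetric] tangential_def vec_eq_iff axis_def)
      finally show ?thesis using norm_T by metis
    qed
    interpret pucci_subsolution_above_graph \<Omega> u lam Lam \<alpha> \<omega> \<nu>
    proof
      show "norm \<nu> = 1" using norm_T[of \<nu>] by (simp add: \<nu>)
      show "y \<notin> \<Omega>" if "norm y < 1"
        "\<nu> \<bullet> y \<le> norm (y - (\<nu> \<bullet> y) *\<^sub>R \<nu>) * \<omega> (norm (y - (\<nu> \<bullet> y) *\<^sub>R \<nu>))" for y
        using that below by (auto simp: coord tang)
    qed (use \<Omega> u assms \<alpha> mono nonneg in auto)
    have "norm e = 1" using norm_T[of e] by (simp add: e)
    have "\<nu> \<bullet> e = 0" using j unfolding inner_T[of \<nu>] \<nu> e by (simp add: inner_axis_axis)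
    let ?M = "SUP y\<in>\<Omega> \<inter> ball 0 1. ereal (max (u y) 0)"
    have x': "x \<in> \<Omega>" "norm x < 1 / 5" using x by auto
    have "0 < \<nu> \<bullet> x" using height_pos[OF x'(1)] x'(2) by simp
    then have x0: "0 < norm x" by auto
    have pos: "0 < norm x * \<omega>' (norm x)"
      unfolding \<omega>'_def using decay_modulus_pos[where \<omega> = \<omega>, OF modulus_facts x0 x'(2)] x0 by simp
    have upper: "ereal (max (u y) 0) \<le> ?M" if "y \<in> \<Omega>" "norm y < 1" for y
      using that by (intro SUP_upper) auto
    then have "ereal (max (u x) 0) \<le> ?M" using x' by simp
    then have "0 \<le> ?M" by (rule order_trans[rotated]) (simp add: le_max_iff_disj)
    then consider "?M = \<infinity>" | M where "?M = ereal M" "0 \<le> M" by (cases ?M) auto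
    then show ?thesis
    proof cases
      case 1
      then show ?thesis using pos by auto
    next
      case 2
      have uM: "u y \<le> M" if "y \<in> \<Omega>" "norm y < 1" for y
        using upper[OF that] 2(1) by simp
      have bound: "u x \<le> M * norm x * (linear_const \<alpha> * decay_prod (decay_const \<alpha>) \<omega> k)"
        if k: "norm x < decay_scale k" for k
      proof -
        have "u x \<le> (linear_const \<alpha> * M * decay_prod (decay_const \<alpha>) \<omega> k) * (\<nu> \<bullet> x)"
          using decay[OF \<open>norm e = 1\<close> \<open>\<nu> \<bullet> e = 0\<close> assms(4) 2(2) uM x'(1) k] by simp
        also have "\<dots> \<le> (linear_const \<alpha> * M * decay_prod (decay_const \<alpha>) \<omega> k) * norm x"
          using mult_nonneg_nonneg[OF 2(2) C_decay_prod_nonneg[where \<omega> = \<omega>, OF modulus_facts, of k]]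
            norm_cauchy_schwarz[of \<nu> x] norm_\<nu>
          by (intro mult_left_mono) (simp_all add: mult_ac)
        finally show ?thesis by (simp add: mult_ac)
      qed
      have "u x \<le> M * (norm x * \<omega>' (norm x))"
      \<comment> \<open>Dividing by \<open>M * norm x\<close> is impossible for
        \<open>M = 0\<close>, but then the bound at scale 0 already gives u \<le> 0.\<close>
      proof (cases "M = 0")
        case True
        then show ?thesis using bound[of 0] x' by (simp add: decay_scale_0)
      next
        case False
        then have Mx: "0 < M * norm x" using 2(2) x0 by simp
        have "u x / (M * norm x) \<le> \<omega>' (norm x)"
          unfolding \<omega>'_def
          using bound Mx x' by (intro decay_modulus_ge[where \<omega> = \<omega>, OF modulus_facts]) (auto simp: field_simps)
        then show ?thesis using Mx by (simp add: field_simps)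
      qed
      then show ?thesis unfolding 2(1) by simp
    qed
  qed
  moreover have "\<forall>r\<in>{0<..<1 / 5}. 0 \<le> \<omega>' r"
    unfolding \<omega>'_def using decay_modulus_pos[where \<omega> = \<omega>, OF modulus_facts]
    by (auto intro!: less_imp_le)
  moreover have "mono_on {0<..<1 / 5} \<omega>'"
    unfolding \<omega>'_def by (rule mono_on_decay_modulus[where \<omega> = \<omega>, OF modulus_facts])
  moreover have "(\<omega>' \<longlongrightarrow> 0) (at_right 0)"
    unfolding \<omega>'_def by (rule decay_modulus_tendsto_0[where \<omega> = \<omega>, OF modulus_facts div])
  ultimately show ?thesis
    by (intro exI[of _ "1 / 5"] exI[of _ \<omega>'] conjI allI impI ballI) auto
qed

end
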